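(* Let $s\in(1,2]$ and $m,n\in\mathbb{N}$. Then the set $H_s[0,1]=\{f\in C[0,1]:\dim_H G_f([0,1])=s\}$ is $(n,n+m)$-lineable.
   Context: $C[0,1]$ is the real vector space of real-valued continuous functions on $[0,1]$. $G_f(X)=\{(x,f(x)):x\in X\}$ is the graph of $f$ over $X$, and $\dim_H$ denotes Hausdorff dimension. For cardinals $\alpha<\beta$, a subset $A$ of a vector space is $\alpha$-lineable if there is an $\alpha$-dimensional linear subspace $M\subseteq A\cup\{0\}$, and it is $(\alpha,\beta)$-lineable if it is $\alpha$-lineable and for every $\alpha$-dimensional subspace $W_\alpha\subseteq A\cup\{0\}$ there exists a $\beta$-dimensional subspace $W_\beta$ with $W_\alpha\subseteq W_\beta\subseteq A\cup\{0\}$. *)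

theory Defs
  imports "HOL-Analysis.Analysis" "HOL-Library.Function_Algebras"
begin

definition fscale :: "real \<Rightarrow> (real \<Rightarrow> real) \<Rightarrow> (real \<Rightarrow> real)" where
  "fscale c f = (\<lambda>x. c * f x)"

text \<open>C[0,1], represented as continuous functions on [0,1] that vanish outside [0,1]
  (one canonical representative per element).\<close>
definition C01 :: "(real \<Rightarrow> real) set" where
  "C01 = {f. continuous_on {0..1} f \<and> (\<forall>x. x \<notin> {0..1} \<longrightarrow> f x = 0)}"

definition fsubspace :: "(real \<Rightarrow> real) set \<Rightarrow> bool" where
  "fsubspace M = module.subspace fscale M"

definition fdim_eq :: "(real \<Rightarrow> real) set \<Rightarrow> nat \<Rightarrow> bool" where
  "fdim_eq M k = (\<exists>B. finite B \<and> card B = k \<and> \<not> module.dependent fscale B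
                     \<and> module.span fscale B = M)"

definition hausdorff_pre :: "real \<Rightarrow> real \<Rightarrow> 'a::metric_space set \<Rightarrow> ennreal" where
  "hausdorff_pre t \<delta> A =
     (INF U \<in> {U :: nat \<Rightarrow> 'a set. A \<subseteq> (\<Union>i. U i) \<and> (\<forall>i. bounded (U i) \<and> diameter (U i) \<le> \<delta>)}.
        (\<Sum>i. ennreal (diameter (U i) powr t)))"

definition hausdorff_measure :: "real \<Rightarrow> 'a::metric_space set \<Rightarrow> ennreal" where
  "hausdorff_measure t A = (SUP \<delta> \<in> {0<..}. hausdorff_pre t \<delta> A)"

definition hausdorff_dim :: "'a::metric_space set \<Rightarrow> real" where
  "hausdorff_dim A = Inf {t. 0 \<le> t \<and> hausdorff_measure t A = 0}"

definition graph_on :: "(real \<Rightarrow> real) \<Rightarrow> real set \<Rightarrow> (real \<times> real) set" where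
  "graph_on f X = (\<lambda>x. (x, f x)) ` X"

definition H_s :: "real \<Rightarrow> (real \<Rightarrow> real) set" where
  "H_s s = {f \<in> C01. hausdorff_dim (graph_on f {0..1}) = s}"

definition lineable :: "(real \<Rightarrow> real) set \<Rightarrow> nat \<Rightarrow> bool" where
  "lineable A a = (\<exists>M. fsubspace M \<and> fdim_eq M a \<and> M \<subseteq> A \<union> {0})"

definition pair_lineable :: "(real \<Rightarrow> real) set \<Rightarrow> nat \<Rightarrow> nat \<Rightarrow> bool" where
  "pair_lineable A a b = (lineable A a \<and>
     (\<forall>W. fsubspace W \<and> fdim_eq W a \<and> W \<subseteq> A \<union> {0} \<longrightarrow>
        (\<exists>V. fsubspace V \<and> fdim_eq V b \<and> W \<subseteq> V \<and> V \<subseteq> A \<union> {0})))"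

end

theory Submission
  imports Defs "HOL-Real_Asymp.Real_Asymp"
begin

text \<open>
  It suffices to enlarge a finite-dimensional $W \subseteq H_s \cup \{0\}$ by one function $g$
  outside $W$ such that $w + c g \in H_s$ for all $w \in W$, $c \neq 0$.
  Let $E$ be a Cantor set of box dimension $s - 1$, with binary digits, and let $g$ read off the
  digits of a point of $E$ at a sparse sequence of levels $\kappa_0 < \kappa_1 < \dots$ and use them
  as the digits of a number in $[0,1]$; away from $E$ make $g$ locally Lipschitz.

  Upper bound: off $E$ the graph of $w + c g$ is a countable union of Lipschitz images of pieces of the
  graph of $w$, and over $E$ it lies in $E \times [-R,R]$, of box dimension $s$.

  Lower bound: $W$ has a common modulus of continuity up to constants, so $\kappa$ can be chosen so
  sparse that at level $\kappa_j$ the variation of $w$ is negligible against the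
  jump of $g$ caused by the digit at that level. A set of diameter $r$ then determines the
  first $k \approx \log r / \log \rho$ digits of $x$ and in addition the digits at about
  $\log_2 (1/r)$ of the levels $\kappa_j$, so that its mass for the coin-tossing measure is at most
  $r^{s - \varepsilon}$ up to a constant.
\<close>

subsection \<open>Hausdorff null sets\<close>

text \<open>The mesh $\delta$ of the covers can be dropped for null sets: a small sum of the
  $\mathrm{diam}^t$ already bounds each single diameter.\<close>

definition hnull :: "real \<Rightarrow> 'a::metric_space set \<Rightarrow> bool" where
  "hnull t A \<longleftrightarrow> (\<forall>\<epsilon>>0. \<exists>U :: nat \<Rightarrow> 'a set. A \<subseteq> (\<Union>i. U i) \<and> (\<forall>i. bounded (U i)) \<and>
     (\<Sum>i. ennreal (diameter (U i) powr t)) < ennreal \<epsilon>)"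

lemma hausdorff_measure_eq_0_iff:
  assumes "0 \<le> t"
  shows "hausdorff_measure t A = 0 \<longleftrightarrow> hnull t A"
proof
  assume H: "hausdorff_measure t A = 0"
  have "hausdorff_pre t 1 A \<le> hausdorff_measure t A"
    unfolding hausdorff_measure_def by (rule SUP_upper) simp
  then have pre: "hausdorff_pre t 1 A = 0" using H by simp
  show "hnull t A" unfolding hnull_def
  proof (intro allI impI)
    fix \<epsilon> :: real assume "0 < \<epsilon>"
    then have "hausdorff_pre t 1 A < ennreal \<epsilon>" using pre by simp
    then show "\<exists>U. A \<subseteq> (\<Union>i. U i) \<and> (\<forall>i. bounded (U i)) \<and>
        (\<Sum>i. ennreal (diameter (U i) powr t)) < ennreal \<epsilon>"
      unfolding hausdorff_pre_def INF_less_iff by blast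
  qed
next
  assume H: "hnull t A"
  have "hausdorff_pre t \<delta> A \<le> 0" if \<delta>: "0 < \<delta>" for \<delta>
  proof (rule ennreal_le_epsilon)
    fix e :: real assume e: "0 < e"
    let ?e = "min e (\<delta> powr t)"
    have "0 < ?e" using e \<delta> by simp
    then obtain U where U: "A \<subseteq> (\<Union>i. U i)" "\<And>i. bounded (U i)"
      "(\<Sum>i. ennreal (diameter (U i) powr t)) < ennreal ?e"
      using H unfolding hnull_def by blast
    have "diameter (U i) \<le> \<delta>" for i
    proof (rule ccontr)
      assume "\<not> diameter (U i) \<le> \<delta>"
      then have "\<delta> powr t \<le> diameter (U i) powr t"
        using \<delta> assms by (intro powr_mono2) auto
      also have "ennreal (diameter (U i) powr t) < ennreal ?e" using U(3) by (rule ennreal_suminf_lessD)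
      then have "diameter (U i) powr t < ?e"
        by (metis ennreal_leI linorder_not_le)
      finally show False by simp
    qed
    then have "hausdorff_pre t \<delta> A \<le> (\<Sum>i. ennreal (diameter (U i) powr t))"
      unfolding hausdorff_pre_def using U by (intro INF_lower) auto
    also have "\<dots> \<le> ennreal e" using U(3)
      by (meson ennreal_leI less_imp_le min.cobounded1 order.trans)
    finally show "hausdorff_pre t \<delta> A \<le> 0 + ennreal e" by simp
  qed
  then have "hausdorff_measure t A \<le> 0"
    unfolding hausdorff_measure_def by (intro SUP_least) auto
  then show "hausdorff_measure t A = 0" by simp
qed

lemma diameter_leI:
  assumes "0 \<le> d" "\<And>x y. x \<in> S \<Longrightarrow> y \<in> S \<Longrightarrow> dist x y \<le> d"
  shows "diameter S \<le> d"
  unfolding diameter_def using assms by (auto intro!: cSUP_least)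

lemma hnull_subset: "hnull t B \<Longrightarrow> A \<subseteq> B \<Longrightarrow> hnull t A"
  unfolding hnull_def by (meson order.trans)

text \<open>A cover of total cost below 1 has only sets of diameter at most 1, and for these a
  larger exponent does not increase the summand.\<close>

lemma hnull_mono:
  assumes "hnull t A" "0 \<le> t" "t \<le> t'"
  shows "hnull t' A"
  unfolding hnull_def
proof (intro allI impI)
  fix \<epsilon> :: real assume "0 < \<epsilon>"
  then have "0 < min \<epsilon> 1" by simp
  then obtain U where U: "A \<subseteq> (\<Union>i. U i)" "\<And>i. bounded (U i)"
    "(\<Sum>i. ennreal (diameter (U i) powr t)) < ennreal (min \<epsilon> 1)"
    using assms(1) unfolding hnull_def by blast
  have "ennreal (diameter (U i) powr t') \<le> ennreal (diameter (U i) powr t)" for i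
  proof (cases "diameter (U i) \<le> 1")
    case True
    then show ?thesis using assms(3) diameter_ge_0[OF U(2)] by (intro ennreal_leI powr_mono') auto
  next
    case False
    then have "1 \<le> diameter (U i) powr t" using assms(2) by (intro ge_one_powr_ge_zero) auto
    moreover have "ennreal (diameter (U i) powr t) < ennreal (min \<epsilon> 1)"
      using U(3) by (rule ennreal_suminf_lessD)
    then have "diameter (U i) powr t < min \<epsilon> 1" by (metis ennreal_leI linorder_not_le)
    ultimately show ?thesis by simp
  qed
  then have "(\<Sum>i. ennreal (diameter (U i) powr t')) \<le> (\<Sum>i. ennreal (diameter (U i) powr t))"
    by (intro suminf_le) auto
  also note U(3)
  also have "ennreal (min \<epsilon> 1) \<le> ennreal \<epsilon>" by (intro ennreal_leI) simp
  finally show "\<exists>U. A \<subseteq> (\<Union>i. U i) \<and> (\<forall>i. bounded (U i)) \<and>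
        (\<Sum>i. ennreal (diameter (U i) powr t')) < ennreal \<epsilon>" using U by blast
qed

lemma hnull_finite_covers:
  assumes "0 \<le> t"
  and cov: "\<And>\<epsilon>. 0 < \<epsilon> \<Longrightarrow> \<exists>\<U> \<delta>. finite \<U> \<and> A \<subseteq> \<Union>\<U> \<and> (\<forall>U\<in>\<U>. bounded U \<and> diameter U \<le> \<delta>) \<and>
     real (card \<U>) * \<delta> powr t < \<epsilon>"
  shows "hnull t A"
  unfolding hnull_def
proof (intro allI impI)
  fix \<epsilon> :: real assume "0 < \<epsilon>"
  then obtain \<U> \<delta> where U: "finite \<U>" "A \<subseteq> \<Union>\<U>" "\<And>U. U\<in>\<U> \<Longrightarrow> bounded U \<and> diameter U \<le> \<delta>"
    "real (card \<U>) * \<delta> powr t < \<epsilon>"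
    using cov by metis
  obtain h where h: "bij_betw h {..<card \<U>} \<U>"
    using U(1) by (metis atLeast0LessThan ex_bij_betw_nat_finite)
  \<comment> \<open>Padding with empty sets is free: their diameter is 0, and
    \<open>0 powr t = 0\<close> even for \<open>t = 0\<close>.\<close>
  define V where "V i = (if i < card \<U> then h i else {})" for i
  have hi: "h i \<in> \<U>" if "i < card \<U>" for i using h that by (auto simp: bij_betw_def)
  have "(\<Sum>i. ennreal (diameter (V i) powr t)) = (\<Sum>i<card \<U>. ennreal (diameter (V i) powr t))"
    by (rule suminf_finite) (auto simp: V_def)
  also have "\<dots> \<le> (\<Sum>i<card \<U>. ennreal (\<delta> powr t))"
  proof (intro sum_mono ennreal_leI powr_mono2 assms)
    fix i assume "i \<in> {..<card \<U>}"
    then show "0 \<le> diameter (V i)" "diameter (V i) \<le> \<delta>"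
      using U(3)[OF hi[of i]] diameter_ge_0[of "h i"] by (simp_all add: V_def)
  qed
  also have "\<dots> = ennreal (real (card \<U>) * \<delta> powr t)"
    by (simp add: ennreal_mult ennreal_of_nat_eq_real_of_nat)
  also have "\<dots> < ennreal \<epsilon>" using U(4) \<open>0 < \<epsilon>\<close> by (simp add: ennreal_lessI)
  finally have 1: "(\<Sum>i. ennreal (diameter (V i) powr t)) < ennreal \<epsilon>" .
  have 2: "bounded (V i)" for i using U(3)[OF hi[of i]] by (simp add: V_def)
  have "\<Union>\<U> \<subseteq> (\<Union>i. V i)"
  proof
    fix x assume "x \<in> \<Union>\<U>"
    then obtain i where "i < card \<U>" "x \<in> h i" using h by (auto simp: bij_betw_def)
    then show "x \<in> (\<Union>i. V i)" by (auto simp: V_def)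
  qed
  with U(2) have "A \<subseteq> (\<Union>i. V i)" by (rule subset_trans)
  with 1 2 show "\<exists>U. A \<subseteq> (\<Union>i. U i) \<and> (\<forall>i. bounded (U i)) \<and>
        (\<Sum>i. ennreal (diameter (U i) powr t)) < ennreal \<epsilon>" by (intro exI[of _ V]) simp
qed

lemma hnull_lipschitz_image:
  assumes "hnull t A" "0 \<le> t" and f: "L-lipschitz_on A f"
  shows "hnull t (f ` A)"
  unfolding hnull_def
proof (intro allI impI)
  fix \<epsilon> :: real assume e: "0 < \<epsilon>"
  \<comment> \<open>Since \<open>L\<close> may be 0, it is enlarged so that \<open>K powr t\<close>
    is positive and can be divided by.\<close>
  define K where "K = max 1 L"
  have K: "1 \<le> K" "L \<le> K" by (auto simp: K_def)
  have "0 < \<epsilon> / K powr t" using e K by simp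
  then obtain U where U: "A \<subseteq> (\<Union>i. U i)" "\<And>i. bounded (U i)"
    "(\<Sum>i. ennreal (diameter (U i) powr t)) < ennreal (\<epsilon> / K powr t)"
    using assms(1) unfolding hnull_def by blast
  define V where "V i = f ` (U i \<inter> A)" for i
  have dist: "dist x y \<le> K * diameter (U i)" if "x \<in> V i" "y \<in> V i" for x y i
  proof -
    obtain a b where ab: "x = f a" "y = f b" "a \<in> U i" "b \<in> U i" "a \<in> A" "b \<in> A"
      using \<open>x \<in> V i\<close> \<open>y \<in> V i\<close> unfolding V_def by blast
    have "dist x y \<le> L * dist a b" using ab lipschitz_onD[OF f] by blast
    also have "\<dots> \<le> K * dist a b" using K by (intro mult_right_mono) auto
    also have "\<dots> \<le> K * diameter (U i)" using K U ab by (intro mult_left_mono diameter_bounded_bound) auto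
    finally show ?thesis .
  qed
  have bV: "bounded (V i)" for i unfolding bounded_two_points using dist by blast
  have dV: "diameter (V i) \<le> K * diameter (U i)" for i
    using K diameter_ge_0[OF U(2)[of i]] dist by (intro diameter_leI mult_nonneg_nonneg) auto
  have "ennreal (diameter (V i) powr t) \<le> ennreal (K powr t) * ennreal (diameter (U i) powr t)" for i
  proof -
    have "diameter (V i) powr t \<le> (K * diameter (U i)) powr t"
      by (intro powr_mono2 assms dV diameter_ge_0 bV)
    also have "\<dots> = K powr t * diameter (U i) powr t"
      using K diameter_ge_0[OF U(2)] by (simp add: powr_mult)
    finally show ?thesis by (simp add: ennreal_mult[symmetric] ennreal_leI)
  qed
  then have "(\<Sum>i. ennreal (diameter (V i) powr t)) \<le> (\<Sum>i. ennreal (K powr t) * ennreal (diameter (U i) powr t))"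
    by (intro suminf_le) auto
  also have "\<dots> = ennreal (K powr t) * (\<Sum>i. ennreal (diameter (U i) powr t))" by simp
  also have "\<dots> < ennreal (K powr t) * ennreal (\<epsilon> / K powr t)"
    using U(3) K by (intro ennreal_mult_strict_left_mono) auto
  also have "\<dots> = ennreal \<epsilon>" using K e by (simp add: ennreal_mult[symmetric])
  finally have 1: "(\<Sum>i. ennreal (diameter (V i) powr t)) < ennreal \<epsilon>" .
  have "f ` A \<subseteq> (\<Union>i. V i)" using U(1) unfolding V_def by blast
  then show "\<exists>U. f ` A \<subseteq> (\<Union>i. U i) \<and> (\<forall>i. bounded (U i)) \<and>
        (\<Sum>i. ennreal (diameter (U i) powr t)) < ennreal \<epsilon>" using 1 bV by blast
qed

lemma hnull_UN:
  fixes A :: "nat \<Rightarrow> 'a::metric_space set"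
  assumes "\<And>n. hnull t (A n)"
  shows "hnull t (\<Union>n. A n)"
  unfolding hnull_def
proof (intro allI impI)
  fix \<epsilon> :: real assume e: "0 < \<epsilon>"
  \<comment> \<open>The budgets add up to \<open>\<epsilon>/2\<close>, which leaves room for the
    strict inequality after the non-strict comparison of the series.\<close>
  have "\<exists>U::nat \<Rightarrow> 'a set. A n \<subseteq> (\<Union>i. U i) \<and> (\<forall>i. bounded (U i)) \<and>
     (\<Sum>i. ennreal (diameter (U i) powr t)) < ennreal (\<epsilon>/4 * (1/2)^n)" for n
    using assms[of n] e unfolding hnull_def by simp
  then obtain U :: "nat \<Rightarrow> nat \<Rightarrow> 'a set" where U: "\<And>n. A n \<subseteq> (\<Union>i. U n i)" "\<And>n i. bounded (U n i)"
    "\<And>n. (\<Sum>i. ennreal (diameter (U n i) powr t)) < ennreal (\<epsilon>/4 * (1/2)^n)" by metis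
  define V where "V k = (case prod_decode k of (n, i) \<Rightarrow> U n i)" for k
  have s: "(\<lambda>n. \<epsilon>/4 * (1/2)^n) sums (\<epsilon>/4 * (1 / (1 - 1/2)))"
    by (intro sums_mult geometric_sums) simp
  have "(\<Sum>k. ennreal (diameter (V k) powr t)) = (\<Sum>n. \<Sum>i. ennreal (diameter (U n i) powr t))"
  proof -
    have "(\<Sum>k. ennreal (diameter (V k) powr t)) =
        (\<Sum>k. ((\<lambda>(n, i). ennreal (diameter (U n i) powr t)) \<circ> prod_decode) k)"
      by (intro suminf_cong) (auto simp: V_def split: prod.splits)
    also have "\<dots> = (\<Sum>n. \<Sum>i. ennreal (diameter (U n i) powr t))"
      unfolding comp_def by (rule suminf_ennreal_2dimen) simp
    finally show ?thesis .
  qed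
  also have "\<dots> \<le> (\<Sum>n. ennreal (\<epsilon>/4 * (1/2)^n))"
    using U(3) by (intro suminf_le) (auto intro: less_imp_le)
  also have "\<dots> = ennreal (\<epsilon>/2)"
    using s e by (subst suminf_ennreal2) (auto simp: sums_iff)
  also have "\<dots> < ennreal \<epsilon>" using e by (simp add: ennreal_lessI)
  finally have 1: "(\<Sum>k. ennreal (diameter (V k) powr t)) < ennreal \<epsilon>" .
  have 2: "bounded (V k)" for k using U(2) by (auto simp: V_def split: prod.splits)
  have "(\<Union>n. A n) \<subseteq> (\<Union>k. V k)"
  proof
    fix x assume "x \<in> (\<Union>n. A n)"
    then obtain n i where "x \<in> U n i" using U(1) by blast
    then have "x \<in> V (prod_encode (n, i))" by (simp add: V_def)
    then show "x \<in> (\<Union>k. V k)" by blast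
  qed
  then show "\<exists>U. (\<Union>n. A n) \<subseteq> (\<Union>i. U i) \<and> (\<forall>i. bounded (U i)) \<and>
        (\<Sum>i. ennreal (diameter (U i) powr t)) < ennreal \<epsilon>" using 1 2 by blast
qed

lemma hnull_Un:
  assumes "hnull t A" "hnull t B"
  shows "hnull t (A \<union> B)"
proof -
  have "hnull t (\<Union>n::nat. if n = 0 then A else B)"
    by (rule hnull_UN) (use assms in auto)
  moreover have "A \<union> B \<subseteq> (\<Union>n::nat. if n = 0 then A else B)" by (auto split: if_splits)
  ultimately show ?thesis by (rule hnull_subset)
qed

section \<open>From null sets to the dimension\<close>

lemma hausdorff_dim_eqI:
  assumes "0 \<le> s" "\<And>t. s < t \<Longrightarrow> hnull t A" "\<And>t. 0 \<le> t \<Longrightarrow> t < s \<Longrightarrow> \<not> hnull t A"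
  shows "hausdorff_dim A = s"
proof -
  let ?D = "{t. 0 \<le> t \<and> hausdorff_measure t A = 0}"
  have D: "?D = {t. 0 \<le> t \<and> hnull t A}" by (auto simp: hausdorff_measure_eq_0_iff)
  have mem: "t \<in> ?D" if "s < t" for t using that assms(1,2) unfolding D by simp
  have "Inf ?D \<le> s"
  proof (rule field_le_epsilon)
    fix e :: real assume "0 < e"
    then show "Inf ?D \<le> s + e" using mem by (intro cInf_lower bdd_belowI[of _ 0]) auto
  qed
  moreover have "s \<le> Inf ?D"
  proof (rule cInf_greatest)
    show "?D \<noteq> {}" using mem[of "s+1"] by auto
    show "s \<le> t" if "t \<in> ?D" for t
      using that assms(3)[of t] unfolding D by (cases "s \<le> t") auto
  qed
  ultimately show ?thesis by (simp add: hausdorff_dim_def)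
qed

text \<open>\<open>Inf {}\<close> is an unspecified real, so one null exponent must be known before
  the value of the infimum says anything.\<close>

lemma hnull_if_dim_less:
  assumes "hausdorff_dim A < t" "{t. 0 \<le> t \<and> hnull t A} \<noteq> {}"
  shows "hnull t A"
proof -
  let ?D = "{t. 0 \<le> t \<and> hausdorff_measure t A = 0}"
  have D: "?D = {t. 0 \<le> t \<and> hnull t A}" by (auto simp: hausdorff_measure_eq_0_iff)
  have "?D \<noteq> {}" using assms(2) unfolding D .
  moreover have "Inf ?D < t" using assms(1) by (simp add: hausdorff_dim_def)
  ultimately obtain t' where "t' \<in> ?D" "t' < t" using cInf_lessD[of ?D t] by blast
  then have "hnull t' A" "0 \<le> t'" "t' \<le> t" unfolding D by auto
  then show ?thesis by (rule hnull_mono)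
qed

section \<open>Null sets from covers at geometric scales\<close>

lemma hnull_geometric_covers:
  fixes A :: "'a::metric_space set"
  assumes "0 < \<rho>" "0 < C" "0 \<le> t" "0 \<le> K" "0 \<le> b" and small: "b * \<rho> powr t < 1"
  and cov: "\<And>k. \<exists>\<U>. finite \<U> \<and> A \<subseteq> \<Union>\<U> \<and> (\<forall>U\<in>\<U>. \<forall>x\<in>U. \<forall>y\<in>U. dist x y \<le> C * \<rho> ^ k) \<and>
     real (card \<U>) \<le> K * b ^ k"
  shows "hnull t A"
proof (rule hnull_finite_covers[OF \<open>0 \<le> t\<close>])
  fix \<epsilon> :: real assume "0 < \<epsilon>"
  \<comment> \<open>The cost of the cover at stage \<open>k\<close> is at most a geometric sequence
    of ratio \<open>b * \<rho> powr t\<close>; this is the usual comparison of Hausdorff with box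
    dimension.\<close>
  have "(\<lambda>k. K * C powr t * (b * \<rho> powr t) ^ k) \<longlonglongrightarrow> K * C powr t * 0"
    using assms by (intro tendsto_intros LIMSEQ_power_zero) auto
  then have "\<forall>\<^sub>F k in sequentially. K * C powr t * (b * \<rho> powr t) ^ k < \<epsilon>"
    using \<open>0 < \<epsilon>\<close> by (intro order_tendstoD(2)) auto
  then obtain k where k: "K * C powr t * (b * \<rho> powr t) ^ k < \<epsilon>"
    by (auto simp: eventually_sequentially)
  obtain \<U> where U: "finite \<U>" "A \<subseteq> \<Union>\<U>" "\<And>U x y. U \<in> \<U> \<Longrightarrow> x \<in> U \<Longrightarrow> y \<in> U \<Longrightarrow> dist x y \<le> C * \<rho> ^ k"
    "real (card \<U>) \<le> K * b ^ k" using cov[of k] by metis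
  have "(C * \<rho> ^ k) powr t = C powr t * (\<rho> powr t) ^ k"
    using assms by (simp add: powr_mult powr_powr mult.commute flip: powr_realpow)
  then have "K * b ^ k * (C * \<rho> ^ k) powr t = K * C powr t * (b * \<rho> powr t) ^ k"
    by (simp add: power_mult_distrib)
  moreover have "real (card \<U>) * (C * \<rho> ^ k) powr t \<le> K * b ^ k * (C * \<rho> ^ k) powr t"
    using U(4) by (intro mult_right_mono) auto
  ultimately have cost: "real (card \<U>) * (C * \<rho> ^ k) powr t < \<epsilon>" using k by linarith
  have "bounded U \<and> diameter U \<le> C * \<rho> ^ k" if "U \<in> \<U>" for U
  proof
    show "bounded U" unfolding bounded_two_points using U(3)[OF that] by blast
    show "diameter U \<le> C * \<rho> ^ k" using U(3)[OF that] assms by (intro diameter_leI) auto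
  qed
  with U(1,2) cost show "\<exists>\<U> \<delta>. finite \<U> \<and> A \<subseteq> \<Union>\<U> \<and> (\<forall>U\<in>\<U>. bounded U \<and> diameter U \<le> \<delta>) \<and>
     real (card \<U>) * \<delta> powr t < \<epsilon>" by (intro exI[of _ \<U>] exI[of _ "C * \<rho> ^ k"]) simp
qed

text \<open>The column over each of the \<open>2 ^ k\<close> balls is cut into about
  \<open>2 * R / \<rho> ^ k\<close> boxes of height \<open>\<rho> ^ k\<close>, so the number of
  boxes grows at rate \<open>2 / \<rho>\<close>; the hypothesis on \<open>t\<close> says that this
  rate times \<open>\<rho> powr t\<close> is below 1. The lemma serves the graph over the Cantor set
  and, with ratio 1/2, the graph over the whole interval.\<close>

lemma hnull_graph_of_covered_set:
  fixes A :: "real set"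
  assumes \<rho>: "0 < \<rho>" "\<rho> \<le> 1" and C: "0 < C" and R: "0 \<le> R" "\<And>x. x \<in> A \<Longrightarrow> \<bar>f x\<bar> \<le> R"
    and t: "0 \<le> t" "2 * \<rho> powr (t - 1) < 1"
    and cov: "\<And>k. \<exists>P. finite P \<and> card P \<le> 2 ^ k \<and> A \<subseteq> (\<Union>p\<in>P. cball p (C * \<rho> ^ k))"
  shows "hnull t (graph_on f A)"
proof (rule hnull_geometric_covers[of \<rho> "2 * C + 1" t "2 * R + 2" "2 / \<rho>"])
  show "2 / \<rho> * \<rho> powr t < 1" using t \<rho> by (simp add: powr_diff)
  fix k
  obtain P where P: "finite P" "card P \<le> 2 ^ k" "A \<subseteq> (\<Union>p\<in>P. cball p (C * \<rho> ^ k))"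
    using cov[of k] by metis
  define \<eta> where "\<eta> = \<rho> ^ k"
  have \<eta>: "0 < \<eta>" "\<eta> \<le> 1" using \<rho> by (auto simp: \<eta>_def power_le_one)
  define N where "N = nat \<lfloor>2 * R / \<eta>\<rfloor> + 1"
  define Q where "Q p j = cball p (C * \<eta>) \<times> {- R + real j * \<eta> .. - R + (real j + 1) * \<eta>}" for p :: real and j :: nat
  define \<U> where "\<U> = (\<lambda>(p, j). Q p j) ` (P \<times> {..<N})"
  have "finite \<U>" using P by (simp add: \<U>_def)
  moreover have "graph_on f A \<subseteq> \<Union>\<U>"
  proof
    fix z assume "z \<in> graph_on f A"
    then obtain x where x: "x \<in> A" "z = (x, f x)" by (auto simp: graph_on_def)
    then obtain p where p: "p \<in> P" "x \<in> cball p (C * \<eta>)" using P(3) unfolding \<eta>_def by blast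
    define j where "j = nat \<lfloor>(f x + R) / \<eta>\<rfloor>"
    have fx: "0 \<le> f x + R" "f x + R \<le> 2 * R" using R(2)[OF x(1)] by auto
    have "\<lfloor>(f x + R) / \<eta>\<rfloor> \<le> \<lfloor>2 * R / \<eta>\<rfloor>"
      using fx \<eta> by (intro floor_mono divide_right_mono) auto
    then have "j < N" unfolding j_def N_def by linarith
    have "0 \<le> (f x + R) / \<eta>" using fx \<eta> by auto
    then have "real j \<le> (f x + R) / \<eta>" "(f x + R) / \<eta> \<le> real j + 1" unfolding j_def by linarith+
    then have "real j * \<eta> \<le> f x + R" "f x + R \<le> (real j + 1) * \<eta>"
      using \<eta> by (simp_all add: pos_le_divide_eq pos_divide_le_eq)
    then have "z \<in> Q p j" using x p unfolding Q_def by auto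
    then show "z \<in> \<Union>\<U>" using p \<open>j < N\<close> unfolding \<U>_def by auto
  qed
  moreover have "dist x y \<le> (2 * C + 1) * \<rho> ^ k" if "U \<in> \<U>" "x \<in> U" "y \<in> U" for U x y
  proof -
    obtain p j where U: "U = Q p j" using \<open>U \<in> \<U>\<close> by (auto simp: \<U>_def)
    have "\<bar>fst x - fst y\<bar> \<le> 2 * C * \<eta>" "\<bar>snd x - snd y\<bar> \<le> \<eta>"
      using that(2,3) by (auto simp: U Q_def dist_real_def algebra_simps abs_le_iff)
    moreover have "dist x y \<le> \<bar>fst x - fst y\<bar> + \<bar>snd x - snd y\<bar>"
      using sqrt_sum_squares_le_sum_abs by (simp add: dist_prod_def dist_real_def)
    ultimately show ?thesis unfolding \<eta>_def[symmetric] by (simp add: algebra_simps)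
  qed
  moreover have "real (card \<U>) \<le> (2 * R + 2) * (2 / \<rho>) ^ k"
  proof -
    have "card \<U> \<le> card (P \<times> {..<N})" unfolding \<U>_def using P by (intro card_image_le) auto
    also have "\<dots> \<le> 2 ^ k * N" using P by simp
    finally have "real (card \<U>) \<le> real (2 ^ k * N)" by (rule of_nat_mono)
    then have "real (card \<U>) \<le> 2 ^ k * real N" by simp
    also have "real N \<le> (2 * R + 2) / \<eta>"
    proof -
      have "0 \<le> 2 * R / \<eta>" using R \<eta> by simp
      then have "real N \<le> 2 * R / \<eta> + 1" unfolding N_def by linarith
      also have "\<dots> \<le> 2 * R / \<eta> + 2 / \<eta>" using \<eta> by (simp add: pos_le_divide_eq)
      finally show ?thesis by (simp add: add_divide_distrib)
    qed
    then have "2 ^ k * real N \<le> 2 ^ k * ((2 * R + 2) / \<eta>)" by (intro mult_left_mono) auto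
    also have "\<dots> = (2 * R + 2) * (2 / \<rho>) ^ k" by (simp add: \<eta>_def power_divide)
    finally show ?thesis .
  qed
  ultimately show "\<exists>\<U>. finite \<U> \<and> graph_on f A \<subseteq> \<Union>\<U> \<and> (\<forall>U\<in>\<U>. \<forall>x\<in>U. \<forall>y\<in>U. dist x y \<le> (2 * C + 1) * \<rho> ^ k) \<and>
     real (card \<U>) \<le> (2 * R + 2) * (2 / \<rho>) ^ k" by blast
qed (use \<rho> C R t in auto)

text \<open>The factor 1 keeps the shape \<open>C * \<rho> ^ k\<close> in which
  \<open>hnull_graph_of_covered_set\<close> expects its covers.\<close>

lemma unit_interval_dyadic_cover:
  "\<exists>P. finite P \<and> card P \<le> 2 ^ k \<and> {0..1::real} \<subseteq> (\<Union>p\<in>P. cball p (1 * (1/2) ^ k))"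
proof (intro exI[of _ "(\<lambda>j. real (j + 1) / 2 ^ k) ` {..<2 ^ k}"] conjI)
  show "card ((\<lambda>j. real (j + 1) / 2 ^ k) ` {..<2 ^ k}) \<le> 2 ^ k"
    using card_image_le[of "{..<2 ^ k}" "\<lambda>j. real (j + 1) / 2 ^ k"] by simp
  show "{0..1::real} \<subseteq> (\<Union>p\<in>(\<lambda>j. real (j + 1) / 2 ^ k) ` {..<2 ^ k}. cball p (1 * (1/2) ^ k))"
  proof
    fix x :: real assume x: "x \<in> {0..1}"
    \<comment> \<open>At \<open>x = 1\<close> the floor would be \<open>2 ^ k\<close>, one past the
      last index; the last closed interval takes this point.\<close>
    define j where "j = (if x = 1 then 2 ^ k - 1 else nat \<lfloor>2 ^ k * x\<rfloor>)"
    have j: "j < 2 ^ k \<and> real j \<le> 2 ^ k * x \<and> 2 ^ k * x \<le> real (j + 1)"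
    proof (cases "x = 1")
      case True
      then show ?thesis by (simp add: j_def of_nat_diff)
    next
      case False
      with x have "2 ^ k * x < 2 ^ k" "0 \<le> 2 ^ k * x" by auto
      then have "\<lfloor>2 ^ k * x\<rfloor> < 2 ^ k" "0 \<le> \<lfloor>2 ^ k * x\<rfloor>" by (simp_all add: floor_less_iff)
      then have "j < 2 ^ k" using False by (simp add: j_def nat_less_iff)
      moreover have "real j \<le> 2 ^ k * x \<and> 2 ^ k * x \<le> real (j + 1)"
        using False \<open>0 \<le> \<lfloor>2 ^ k * x\<rfloor>\<close> unfolding j_def by (auto simp: of_nat_nat) linarith+
      ultimately show ?thesis by simp
    qed
    then have "\<bar>real (j + 1) / 2 ^ k - x\<bar> \<le> (1/2) ^ k"
      by (simp add: field_simps abs_le_iff)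
    then have "x \<in> cball (real (j + 1) / 2 ^ k) (1 * (1/2) ^ k)" by (simp add: dist_real_def)
    then show "x \<in> (\<Union>p\<in>(\<lambda>j. real (j + 1) / 2 ^ k) ` {..<2 ^ k}. cball p (1 * (1/2) ^ k))"
      using j by blast
  qed
qed simp

lemma hnull_unit_interval:
  assumes "1 < t"
  shows "hnull t {0..1::real}"
proof (rule hnull_geometric_covers[of "1/2" 2 t 1 2])
  have "(1/2) powr t < (1/2) powr (1::real)" using assms by (intro powr_less_mono') auto
  then show "2 * (1/2) powr t < 1" by simp
  fix k
  obtain P where P: "finite P" "card P \<le> 2 ^ k" "{0..1::real} \<subseteq> (\<Union>p\<in>P. cball p (1 * (1/2) ^ k))"
    using unit_interval_dyadic_cover by metis
  let ?U = "(\<lambda>p. cball p (1 * (1/2) ^ k)) ` P"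
  have "card ?U \<le> 2 ^ k" using card_image_le[OF P(1)] P(2) order.trans by blast
  then have "real (card ?U) \<le> 1 * 2 ^ k" by simp
  moreover have "\<forall>U\<in>?U. \<forall>x\<in>U. \<forall>y\<in>U. dist x y \<le> 2 * (1/2) ^ k"
    by (auto simp: dist_real_def)
  ultimately show "\<exists>\<U>. finite \<U> \<and> {0..1::real} \<subseteq> \<Union>\<U> \<and> (\<forall>U\<in>\<U>. \<forall>x\<in>U. \<forall>y\<in>U. dist x y \<le> 2 * (1/2) ^ k) \<and>
     real (card \<U>) \<le> 1 * 2 ^ k" using P by (intro exI[of _ ?U] conjI) auto
qed (use assms in auto)

text \<open>Supplies the null exponent that \<open>hnull_if_dim_less\<close> asks for, which
  membership in \<open>H_s\<close> alone does not give.\<close>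

lemma hnull_graph_above_2:
  assumes "continuous_on {0..1} f" "2 < t"
  shows "hnull t (graph_on f {0..1})"
proof -
  have "bounded (f ` {0..1})"
    using assms(1) compact_Icc by (intro compact_imp_bounded compact_continuous_image)
  then obtain R where R: "\<And>x. x \<in> {0..1} \<Longrightarrow> \<bar>f x\<bar> \<le> R" unfolding bounded_iff by fastforce
  have "(1/2) powr (t - 1) < (1/2) powr (1::real)" using assms by (intro powr_less_mono') auto
  then have "2 * (1/2) powr (t - 1) < 1" by simp
  moreover have "0 \<le> R" using R[of 0] by simp
  ultimately show ?thesis
    using R assms(2) unit_interval_dyadic_cover
    by (intro hnull_graph_of_covered_set[where \<rho> = "1/2" and C = 1 and R = R]) auto
qed

subsection \<open>Cantor sets with binary digits\<close>

text \<open>The digit at level $k$ has weight \<open>ctail \<rho> k - ctail \<rho> (k + 1)\<close>, so \<open>ctail \<rho> k\<close> is the total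
  weight from level $k$ on. The factor $1 + 1/(k+1)$ makes each weight exceed the sum of all later
  ones even for $\rho = 1/2$, the ratio needed when $s = 2$.\<close>

definition ctail :: "real \<Rightarrow> nat \<Rightarrow> real" where
  "ctail \<rho> k = \<rho> ^ k * (1 + 1 / (real k + 1)) / 2"

text \<open>A lower bound, exact for \<open>\<rho> = 1/2\<close>, for the excess of the weight at
  level \<open>k\<close> over the sum of all later weights. It falls short of
  \<open>\<rho> ^ k\<close> only by a polynomial factor, which does not affect dimensions.\<close>

definition cgap :: "real \<Rightarrow> nat \<Rightarrow> real" where
  "cgap \<rho> k = \<rho> ^ k / (2 * (real k + 1) * (real k + 2))"

definition cpoint :: "real \<Rightarrow> (nat \<Rightarrow> bool) \<Rightarrow> real" where
  "cpoint \<rho> e = (\<Sum>k. of_bool (e k) * (ctail \<rho> k - ctail \<rho> (Suc k)))"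

locale cantor_ratio =
  fixes \<rho> :: real
  assumes \<rho>: "0 < \<rho>" "\<rho> \<le> 1/2"
begin

lemma ctail_pos: "0 < ctail \<rho> k"
  using \<rho> by (simp add: ctail_def add_pos_pos)

lemma ctail_le_power: "ctail \<rho> k \<le> \<rho> ^ k"
proof -
  have "\<rho> ^ k * (1 + 1 / (real k + 1)) \<le> \<rho> ^ k * 2"
    using \<rho> by (intro mult_left_mono) auto
  then show ?thesis by (simp add: ctail_def)
qed

lemma ctail_tendsto_0: "ctail \<rho> \<longlonglongrightarrow> 0"
proof (rule tendsto_sandwich[of "\<lambda>_. 0" _ _ "\<lambda>k. \<rho> ^ k"])
  show "(\<lambda>k. \<rho> ^ k) \<longlonglongrightarrow> 0" using \<rho> by (intro LIMSEQ_power_zero) auto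
qed (auto simp: ctail_le_power less_imp_le[OF ctail_pos])

lemma cgap_pos: "0 < cgap \<rho> k"
  using \<rho> by (simp add: cgap_def)

lemma cgap_le_power: "cgap \<rho> k \<le> \<rho> ^ k"
proof -
  have "1 * 1 \<le> (2 * (real k + 1)) * (real k + 2)" by (intro mult_mono) auto
  then show ?thesis using \<rho> by (simp add: cgap_def pos_divide_le_eq mult_le_cancel_left1)
qed

lemma cgap_tendsto_0: "cgap \<rho> \<longlonglongrightarrow> 0"
proof (rule tendsto_sandwich[of "\<lambda>_. 0" _ _ "\<lambda>k. \<rho> ^ k"])
  show "(\<lambda>k. \<rho> ^ k) \<longlonglongrightarrow> 0" using \<rho> by (intro LIMSEQ_power_zero) auto
qed (auto simp: cgap_le_power less_imp_le[OF cgap_pos])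

text \<open>As \<open>2 * \<rho> \<le> 1\<close>, the worst case is ratio 1/2, where the excess is
  half of \<open>\<rho> ^ k\<close> times the difference of 1/(k+1) and 1/(k+2).\<close>

lemma cgap_le: "cgap \<rho> k \<le> ctail \<rho> k - 2 * ctail \<rho> (Suc k)"
proof -
  define y z where "y = 1 / (real k + 2)" and "z = 1 / (real k + 1)"
  have "2 * \<rho> * (1 + y) \<le> 1 * (1 + y)"
    using \<rho> by (intro mult_right_mono) (auto simp: y_def)
  then have "\<rho> ^ k * (z - y) \<le> \<rho> ^ k * ((1 + z) - 2 * \<rho> * (1 + y))"
    using \<rho> by (intro mult_left_mono) auto
  moreover have "cgap \<rho> k = \<rho> ^ k * (z - y) / 2"
  proof -
    have "z - y = 1 / ((real k + 1) * (real k + 2))" by (simp add: divide_simps y_def z_def)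
    then show ?thesis by (simp add: cgap_def)
  qed
  moreover have "ctail \<rho> k = \<rho> ^ k * (1 + z) / 2" by (simp add: ctail_def z_def)
  moreover have "ctail \<rho> (Suc k) = \<rho> ^ k * \<rho> * (1 + y) / 2"
    by (simp add: ctail_def y_def add.commute)
  ultimately show ?thesis by (simp add: algebra_simps)
qed

lemma ctail_diff_pos: "0 < ctail \<rho> k - ctail \<rho> (Suc k)"
  using cgap_le[of k] cgap_pos[of k] ctail_pos[of "Suc k"] by linarith

lemma cgap_antimono: "i \<le> j \<Longrightarrow> cgap \<rho> j \<le> cgap \<rho> i"
  unfolding cgap_def using \<rho>
  by (intro frac_le mult_mono power_decreasing) auto

lemma ctail_diff_sums: "(\<lambda>i. ctail \<rho> (i + k) - ctail \<rho> (Suc (i + k))) sums ctail \<rho> k"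
  using telescope_sums'[OF LIMSEQ_ignore_initial_segment[OF ctail_tendsto_0, of k]] by simp

lemma summable_cpoint: "summable (\<lambda>k. of_bool (e k) * (ctail \<rho> k - ctail \<rho> (Suc k)))"
proof (rule summable_comparison_test')
  show "summable (\<lambda>k. ctail \<rho> k - ctail \<rho> (Suc k))"
    using ctail_diff_sums[of 0] by (simp add: sums_iff)
  show "norm (of_bool (e k) * (ctail \<rho> k - ctail \<rho> (Suc k))) \<le> ctail \<rho> k - ctail \<rho> (Suc k)" for k
    using ctail_diff_pos[of k] by simp
qed

lemma cpoint_agree:
  assumes "\<And>i. i < k \<Longrightarrow> e i = e' i"
  shows "\<bar>cpoint \<rho> e - cpoint \<rho> e'\<bar> \<le> ctail \<rho> k"
proof -
  define a where "a i = ctail \<rho> i - ctail \<rho> (Suc i)" for i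
  define d where "d i = of_bool (e i) * a i - of_bool (e' i) * a i" for i
  have "cpoint \<rho> e - cpoint \<rho> e' = suminf d"
    unfolding cpoint_def d_def a_def by (intro suminf_diff summable_cpoint)
  also have "\<dots> = (\<Sum>i. d (i + k)) + sum d {..<k}"
    unfolding d_def a_def by (intro suminf_split_initial_segment summable_diff summable_cpoint)
  also have "sum d {..<k} = 0" using assms by (simp add: d_def)
  finally have eq: "cpoint \<rho> e - cpoint \<rho> e' = (\<Sum>i. d (i + k))" by simp
  have le: "norm (d (i + k)) \<le> a (i + k)" for i
    using ctail_diff_pos[of "i + k"] by (simp add: d_def a_def)
  have "(\<lambda>i. a (i + k)) sums ctail \<rho> k" using ctail_diff_sums unfolding a_def .
  then have "norm (\<Sum>i. d (i + k)) \<le> ctail \<rho> k"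
    using norm_suminf_le[of "\<lambda>i. d (i + k)" "\<lambda>i. a (i + k)"] le by (simp add: sums_iff)
  then show ?thesis using eq by simp
qed

lemma cpoint_flip: "cpoint \<rho> (e(k := True)) = cpoint \<rho> (e(k := False)) + (ctail \<rho> k - ctail \<rho> (Suc k))"
proof -
  define a where "a i = ctail \<rho> i - ctail \<rho> (Suc i)" for i
  have "cpoint \<rho> (e(k := True)) - cpoint \<rho> (e(k := False)) =
     (\<Sum>i. of_bool ((e(k := True)) i) * a i - of_bool ((e(k := False)) i) * a i)"
    unfolding cpoint_def a_def by (intro suminf_diff summable_cpoint)
  also have "\<dots> = (\<Sum>i\<in>{k}. of_bool ((e(k := True)) i) * a i - of_bool ((e(k := False)) i) * a i)"
    by (intro suminf_finite) auto
  finally show ?thesis by (simp add: a_def)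
qed

text \<open>The first differing digit contributes its full weight, of which the later digits can
  take back at most \<open>ctail \<rho> (Suc k)\<close>.\<close>

lemma cpoint_separated:
  assumes "\<And>i. i < k \<Longrightarrow> e i = e' i" "e k \<noteq> e' k"
  shows "cgap \<rho> k \<le> \<bar>cpoint \<rho> e - cpoint \<rho> e'\<bar>"
proof -
  have *: "cgap \<rho> k \<le> cpoint \<rho> u - cpoint \<rho> v"
    if "\<And>i. i < k \<Longrightarrow> u i = v i" "u k" "\<not> v k" for u v
  proof -
    \<comment> \<open>With digit \<open>k\<close> of \<open>u\<close> cleared, both sequences agree
      up to and including level \<open>k\<close>.\<close>
    have "\<bar>cpoint \<rho> (u(k := False)) - cpoint \<rho> v\<bar> \<le> ctail \<rho> (Suc k)"
      using that by (intro cpoint_agree) (auto simp: less_Suc_eq)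
    moreover have "u(k := True) = u" using that by (simp add: fun_eq_iff)
    ultimately show ?thesis using cpoint_flip[of u k] cgap_le[of k] by simp
  qed
  show ?thesis using *[of e e'] *[of e' e] assms by (cases "e k") fastforce+
qed

lemma cpoint_range: "cpoint \<rho> e \<in> {0..1}"
proof -
  have "0 \<le> cpoint \<rho> e" unfolding cpoint_def
    using ctail_diff_pos by (intro suminf_nonneg summable_cpoint) (simp add: less_imp_le)
  moreover have "cpoint \<rho> (\<lambda>_. False) = 0" by (simp add: cpoint_def)
  moreover have "ctail \<rho> 0 = 1" by (simp add: ctail_def)
  ultimately show ?thesis using cpoint_agree[of 0 e "\<lambda>_. False"] by simp
qed

text \<open>The centres are the points whose digits vanish from level \<open>k\<close> on. One
  \<open>\<rho> ^ k\<close> of the radius pays for the discarded tail, the other for the passage to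
  the closure.\<close>

lemma closure_cpoint_cover:
  "\<exists>P. finite P \<and> card P \<le> 2 ^ k \<and> closure (range (cpoint \<rho>)) \<subseteq> (\<Union>p\<in>P. cball p (2 * \<rho> ^ k))"
proof (intro exI[of _ "(\<lambda>S. cpoint \<rho> (\<lambda>i. i \<in> S)) ` Pow {..<k}"] conjI)
  show "card ((\<lambda>S. cpoint \<rho> (\<lambda>i. i \<in> S)) ` Pow {..<k}) \<le> 2 ^ k"
    using card_image_le[of "Pow {..<k}" "\<lambda>S. cpoint \<rho> (\<lambda>i. i \<in> S)"] by (simp add: card_Pow)
  show "closure (range (cpoint \<rho>)) \<subseteq> (\<Union>p\<in>(\<lambda>S. cpoint \<rho> (\<lambda>i. i \<in> S)) ` Pow {..<k}. cball p (2 * \<rho> ^ k))"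
  proof
    fix x assume "x \<in> closure (range (cpoint \<rho>))"
    then obtain e where e: "dist (cpoint \<rho> e) x < \<rho> ^ k"
      using \<rho> unfolding closure_approachable by (metis imageE zero_less_power)
    let ?S = "{i. i < k \<and> e i}"
    have "\<bar>cpoint \<rho> (\<lambda>i. i \<in> ?S) - cpoint \<rho> e\<bar> \<le> ctail \<rho> k"
      by (intro cpoint_agree) auto
    then have "x \<in> cball (cpoint \<rho> (\<lambda>i. i \<in> ?S)) (2 * \<rho> ^ k)"
      using e ctail_le_power[of k] by (auto simp: dist_real_def)
    moreover have "?S \<in> Pow {..<k}" by auto
    ultimately show "x \<in> (\<Union>p\<in>(\<lambda>S. cpoint \<rho> (\<lambda>i. i \<in> S)) ` Pow {..<k}. cball p (2 * \<rho> ^ k))" by blast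
  qed
qed simp

end

text \<open>Ratio 1/2 governs the values of \<open>osc\<close>, whereas \<open>\<rho>\<close>
  governs the points where they are taken.\<close>

interpretation half: cantor_ratio "1/2"
  by standard auto

subsection \<open>The oscillating function\<close>

locale cantor_digits = cantor_ratio +
  fixes \<kappa> :: "nat \<Rightarrow> nat"
begin

text \<open>On the Cantor set \<open>tent j\<close> is the digit at level \<open>\<kappa> j\<close>. The summand \<open>real j\<close> of the slope shrinks
  the supports of the tents to the Cantor set, so that off it \<open>osc\<close> is locally a finite sum of
  Lipschitz functions.\<close>

definition slope :: "nat \<Rightarrow> real" where
  "slope j = 1 / cgap \<rho> (\<kappa> j) + real j"

definition tent :: "nat \<Rightarrow> real \<Rightarrow> real" where
  "tent j x = (SUP e. max 0 (of_bool (e (\<kappa> j)) - slope j * \<bar>x - cpoint \<rho> e\<bar>))"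

definition osc :: "real \<Rightarrow> real" where
  "osc x = (\<Sum>j. tent j x * (ctail (1/2) j - ctail (1/2) (Suc j)))"

lemma slope_pos: "0 < slope j"
  unfolding slope_def using cgap_pos[of "\<kappa> j"] by (simp add: add_pos_nonneg)

lemma slope_cgap: "1 \<le> slope j * cgap \<rho> (\<kappa> j)"
  using cgap_pos[of "\<kappa> j"] by (simp add: slope_def distrib_right)

lemma tent_term_le: "max 0 (of_bool b - slope j * \<bar>y\<bar>) \<le> 1"
  using slope_pos[of j] by (auto intro: order.trans[of _ 0])

lemma tent_bdd: "bdd_above (range (\<lambda>e. max 0 (of_bool (e (\<kappa> j)) - slope j * \<bar>x - cpoint \<rho> e\<bar>)))"
  using tent_term_le by (intro bdd_aboveI2)

lemma tent_le_1: "tent j x \<le> 1"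
  unfolding tent_def using tent_term_le by (intro cSUP_least) auto

lemma tent_nonneg: "0 \<le> tent j x"
  unfolding tent_def by (rule cSUP_upper2[OF tent_bdd]) auto

lemma tent_lipschitz: "\<bar>tent j x - tent j y\<bar> \<le> slope j * \<bar>x - y\<bar>"
proof -
  have *: "tent j x \<le> tent j y + slope j * \<bar>x - y\<bar>" for x y
  proof -
    have "max 0 (of_bool (e (\<kappa> j)) - slope j * \<bar>x - cpoint \<rho> e\<bar>) \<le> tent j y + slope j * \<bar>x - y\<bar>" for e
    proof -
      have "slope j * \<bar>y - cpoint \<rho> e\<bar> \<le> slope j * (\<bar>x - cpoint \<rho> e\<bar> + \<bar>x - y\<bar>)"
        using slope_pos[of j] by (intro mult_left_mono) auto
      then have "max 0 (of_bool (e (\<kappa> j)) - slope j * \<bar>x - cpoint \<rho> e\<bar>)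
          \<le> max 0 (of_bool (e (\<kappa> j)) - slope j * \<bar>y - cpoint \<rho> e\<bar>) + slope j * \<bar>x - y\<bar>"
        using slope_pos[of j] by (auto simp: distrib_left max_def)
      also have "max 0 (of_bool (e (\<kappa> j)) - slope j * \<bar>y - cpoint \<rho> e\<bar>) \<le> tent j y"
        unfolding tent_def by (rule cSUP_upper[OF _ tent_bdd]) simp
      finally show ?thesis by simp
    qed
    then show ?thesis unfolding tent_def[of j x] by (intro cSUP_least) auto
  qed
  show ?thesis using *[of x y] *[of y x] by (simp add: abs_le_iff abs_minus_commute)
qed

text \<open>Points that differ in the digit at level \<open>\<kappa> j\<close> first differ at that
  level or earlier, hence lie at least \<open>cgap \<rho> (\<kappa> j)\<close> apart; over this
  distance a cone of the given slope has dropped to 0.\<close>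

lemma tent_cpoint: "tent j (cpoint \<rho> e) = of_bool (e (\<kappa> j))"
proof (rule antisym)
  show "tent j (cpoint \<rho> e) \<le> of_bool (e (\<kappa> j))"
  proof (cases "e (\<kappa> j)")
    case True
    then show ?thesis using tent_le_1 by simp
  next
    case False
    have "of_bool (e' (\<kappa> j)) - slope j * \<bar>cpoint \<rho> e - cpoint \<rho> e'\<bar> \<le> 0" for e'
    proof (cases "e' (\<kappa> j)")
      case True
      define i where "i = (LEAST i. e i \<noteq> e' i)"
      have ne: "e (\<kappa> j) \<noteq> e' (\<kappa> j)" using True False by simp
      then have "e i \<noteq> e' i" unfolding i_def by (rule LeastI)
      moreover have "e l = e' l" if "l < i" for l using that not_less_Least unfolding i_def by blast
      ultimately have "cgap \<rho> i \<le> \<bar>cpoint \<rho> e - cpoint \<rho> e'\<bar>" by (intro cpoint_separated)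
      moreover have "i \<le> \<kappa> j" unfolding i_def using ne by (rule Least_le)
      then have "cgap \<rho> (\<kappa> j) \<le> cgap \<rho> i" by (rule cgap_antimono)
      ultimately have "slope j * cgap \<rho> (\<kappa> j) \<le> slope j * \<bar>cpoint \<rho> e - cpoint \<rho> e'\<bar>"
        using slope_pos[of j] by (intro mult_left_mono) auto
      then show ?thesis using slope_cgap[of j] True by simp
    next
      case False
      then show ?thesis using slope_pos[of j] by simp
    qed
    then show ?thesis using False unfolding tent_def by (intro cSUP_least) auto
  qed
  show "of_bool (e (\<kappa> j)) \<le> tent j (cpoint \<rho> e)"
    unfolding tent_def by (rule cSUP_upper2[OF tent_bdd, of e]) auto
qed

lemma tent_eventually_0:
  assumes "x \<notin> closure (range (cpoint \<rho>))"
  shows "\<exists>j. \<forall>i\<ge>j. tent i x = 0"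
proof -
  obtain d where d: "0 < d" "\<And>e. d \<le> \<bar>x - cpoint \<rho> e\<bar>"
    using assms unfolding closure_approachable
    by (metis abs_minus_commute dist_real_def linorder_not_le rangeI)
  obtain j :: nat where j: "1 / d < real j" using reals_Archimedean2 by blast
  have "tent i x = 0" if "j \<le> i" for i
  proof -
    have "1 / d \<le> slope i" using j that cgap_pos[of "\<kappa> i"] by (simp add: slope_def add_increasing)
    then have "1 \<le> slope i * d" using d by (simp add: pos_divide_le_eq)
    moreover have "slope i * d \<le> slope i * \<bar>x - cpoint \<rho> e\<bar>" for e
      using d slope_pos[of i] by (intro mult_left_mono) auto
    ultimately have "of_bool (e (\<kappa> i)) - slope i * \<bar>x - cpoint \<rho> e\<bar> \<le> 0" for e
      by (meson diff_le_0_iff_le of_bool_less_eq_one order.trans)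
    then have "max 0 (of_bool (e (\<kappa> i)) - slope i * \<bar>x - cpoint \<rho> e\<bar>) = 0" for e by simp
    then show ?thesis by (simp add: tent_def)
  qed
  then show ?thesis by blast
qed

lemma continuous_on_osc: "continuous_on S osc"
proof -
  let ?a = "\<lambda>j. ctail (1/2) j - ctail (1/2) (Suc j)"
  have "uniform_limit S (\<lambda>n x. \<Sum>j<n. tent j x * ?a j) osc sequentially"
    unfolding osc_def
  proof (rule Weierstrass_m_test)
    show "norm (tent j x * ?a j) \<le> ?a j" for j x
      using half.ctail_diff_pos[of j] tent_nonneg[of j x] tent_le_1[of j x]
      by (simp add: abs_mult mult_le_cancel_right2)
    show "summable ?a" using half.ctail_diff_sums[of 0] by (simp add: sums_iff)
  qed
  moreover have "continuous_on S (tent j)" for j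
  proof (rule lipschitz_on_continuous_on)
    show "(slope j)-lipschitz_on S (tent j)"
      using tent_lipschitz slope_pos[of j] by (intro lipschitz_onI) (auto simp: dist_real_def)
  qed
  then have "continuous_on S (\<lambda>x. \<Sum>j<n. tent j x * ?a j)" for n
    by (intro continuous_intros)
  ultimately show ?thesis
    by (intro uniform_limit_theorem[where F = sequentially]) (auto intro: always_eventually)
qed

lemma osc_cpoint: "osc (cpoint \<rho> e) = cpoint (1/2) (\<lambda>j. e (\<kappa> j))"
  by (simp add: osc_def cpoint_def[of "1/2"] tent_cpoint)

text \<open>Where all tents from \<open>j\<close> on vanish, \<open>osc\<close> is a sum of
  \<open>j\<close> Lipschitz functions, so one constant works for all pairs of such points, however
  far apart.\<close>

lemma osc_lipschitz: "\<exists>L\<ge>0. \<forall>x y. (\<forall>i\<ge>j. tent i x = 0) \<longrightarrow> (\<forall>i\<ge>j. tent i y = 0) \<longrightarrow>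
  \<bar>osc x - osc y\<bar> \<le> L * \<bar>x - y\<bar>"
proof (intro exI[of _ "\<Sum>i<j. slope i * (ctail (1/2) i - ctail (1/2) (Suc i))"] conjI allI impI)
  let ?a = "\<lambda>j. ctail (1/2) j - ctail (1/2) (Suc j)"
  show "0 \<le> (\<Sum>i<j. slope i * ?a i)"
    using slope_pos half.ctail_diff_pos by (intro sum_nonneg mult_nonneg_nonneg) (auto intro: less_imp_le)
  fix x y assume xy: "\<forall>i\<ge>j. tent i x = 0" "\<forall>i\<ge>j. tent i y = 0"
  have osc: "osc z = (\<Sum>i<j. tent i z * ?a i)" if "\<forall>i\<ge>j. tent i z = 0" for z
    unfolding osc_def using that by (intro suminf_finite) auto
  have "\<bar>osc x - osc y\<bar> = \<bar>\<Sum>i<j. (tent i x - tent i y) * ?a i\<bar>"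
    by (simp add: osc xy sum_subtractf left_diff_distrib)
  also have "\<dots> \<le> (\<Sum>i<j. \<bar>(tent i x - tent i y) * ?a i\<bar>)" by (rule sum_abs)
  also have "\<dots> \<le> (\<Sum>i<j. slope i * \<bar>x - y\<bar> * ?a i)"
    using tent_lipschitz half.ctail_diff_pos
    by (intro sum_mono) (simp add: abs_mult abs_of_pos mult_right_mono)
  also have "\<dots> = (\<Sum>i<j. slope i * ?a i) * \<bar>x - y\<bar>"
    unfolding sum_distrib_right by (intro sum.cong) auto
  finally show "\<bar>osc x - osc y\<bar> \<le> (\<Sum>i<j. slope i * ?a i) * \<bar>x - y\<bar>" .
qed

lemma hnull_graph_add_osc:
  assumes w: "continuous_on {0..1} w" "hnull t (graph_on w {0..1})"
    and t: "0 \<le> t" "2 * \<rho> powr (t - 1) < 1"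
  shows "hnull t (graph_on (\<lambda>x. w x + c * osc x) {0..1})"
proof -
  let ?f = "\<lambda>x. w x + c * osc x"
  define E where "E = closure (range (cpoint \<rho>)) \<inter> {0..1}"
  define A where "A j = {x \<in> {0..1}. \<forall>i\<ge>j. tent i x = 0}" for j
  have "continuous_on {0..1} ?f" by (intro continuous_intros w continuous_on_osc)
  then have "bounded (?f ` {0..1})"
    using compact_Icc by (intro compact_imp_bounded compact_continuous_image)
  then obtain R where R: "\<And>x. x \<in> {0..1} \<Longrightarrow> \<bar>?f x\<bar> \<le> R" unfolding bounded_iff by fastforce
  have "hnull t (graph_on ?f E)"
  proof (rule hnull_graph_of_covered_set[where \<rho> = \<rho> and C = 2 and R = R])
    show "0 \<le> R" using R[of 0] by simp
    show "\<bar>?f x\<bar> \<le> R" if "x \<in> E" for x using that R unfolding E_def by blast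
    show "\<exists>P. finite P \<and> card P \<le> 2 ^ k \<and> E \<subseteq> (\<Union>p\<in>P. cball p (2 * \<rho> ^ k))" for k
      using closure_cpoint_cover[of k] unfolding E_def by blast
  qed (use \<rho> t in auto)
  moreover have "hnull t (graph_on ?f (A j))" for j
  proof -
    obtain L where L: "0 \<le> L" "\<And>x y. x \<in> A j \<Longrightarrow> y \<in> A j \<Longrightarrow> \<bar>osc x - osc y\<bar> \<le> L * \<bar>x - y\<bar>"
      using osc_lipschitz[of j] unfolding A_def by blast
    \<comment> \<open>This shear carries the graph of \<open>w\<close> to the graph of the sum, and
      over \<open>A j\<close> it is Lipschitz because \<open>osc\<close> is.\<close>
    let ?h = "\<lambda>z. (fst z, snd z + c * osc (fst z))"
    have "hnull t (graph_on w (A j))"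
      using w(2) by (rule hnull_subset) (auto simp: graph_on_def A_def)
    moreover have "(2 + \<bar>c\<bar> * L)-lipschitz_on (graph_on w (A j)) ?h"
    proof (rule lipschitz_onI)
      fix z z' assume z: "z \<in> graph_on w (A j)" "z' \<in> graph_on w (A j)"
      have "dist (?h z) (?h z') \<le> \<bar>fst z - fst z'\<bar> + \<bar>(snd z + c * osc (fst z)) - (snd z' + c * osc (fst z'))\<bar>"
        using sqrt_sum_squares_le_sum_abs by (simp add: dist_prod_def dist_real_def)
      also have "\<dots> \<le> \<bar>fst z - fst z'\<bar> + \<bar>snd z - snd z'\<bar> + \<bar>c\<bar> * \<bar>osc (fst z) - osc (fst z')\<bar>"
        by (simp add: abs_mult[symmetric] right_diff_distrib)
      also have "\<dots> \<le> dist z z' + dist z z' + \<bar>c\<bar> * (L * dist z z')"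
      proof (intro add_mono mult_left_mono)
        show 1: "\<bar>fst z - fst z'\<bar> \<le> dist z z'" "\<bar>snd z - snd z'\<bar> \<le> dist z z'"
          using dist_fst_le[of z z'] dist_snd_le[of z z'] by (simp_all add: dist_real_def)
        have "\<bar>osc (fst z) - osc (fst z')\<bar> \<le> L * \<bar>fst z - fst z'\<bar>"
          using z by (intro L(2)) (auto simp: graph_on_def)
        also have "\<dots> \<le> L * dist z z'" using 1 L by (intro mult_left_mono)
        finally show "\<bar>osc (fst z) - osc (fst z')\<bar> \<le> L * dist z z'" .
      qed simp
      finally show "dist (?h z) (?h z') \<le> (2 + \<bar>c\<bar> * L) * dist z z'" by (simp add: algebra_simps)
    qed (use L in auto)
    ultimately have "hnull t (?h ` graph_on w (A j))" using t by (intro hnull_lipschitz_image)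
    moreover have "?h ` graph_on w (A j) = graph_on ?f (A j)" by (auto simp: graph_on_def image_image)
    ultimately show ?thesis by simp
  qed
  then have "hnull t (\<Union>j. graph_on ?f (A j))" by (rule hnull_UN)
  ultimately have "hnull t (graph_on ?f E \<union> (\<Union>j. graph_on ?f (A j)))" by (rule hnull_Un)
  moreover have "graph_on ?f {0..1} \<subseteq> graph_on ?f E \<union> (\<Union>j. graph_on ?f (A j))"
  proof
    fix z assume "z \<in> graph_on ?f {0..1}"
    then obtain x where x: "x \<in> {0..1}" "z = (x, ?f x)" by (auto simp: graph_on_def)
    show "z \<in> graph_on ?f E \<union> (\<Union>j. graph_on ?f (A j))"
    proof (cases "x \<in> closure (range (cpoint \<rho>))")
      case True
      then show ?thesis using x by (simp add: graph_on_def E_def)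
    next
      case False
      then obtain j where "x \<in> A j" using tent_eventually_0 x(1) unfolding A_def by blast
      then have "z \<in> graph_on ?f (A j)" using x(2) unfolding graph_on_def by blast
      then show ?thesis by blast
    qed
  qed
  ultimately show ?thesis by (rule hnull_subset)
qed

end

subsection \<open>Lower bound for the dimension\<close>

definition bdigit :: "real \<Rightarrow> nat \<Rightarrow> bool" where
  "bdigit u k = odd \<lfloor>2 ^ Suc k * u\<rfloor>"

text \<open>The floor at level \<open>Suc M\<close> is twice the floor at level \<open>M\<close>
  plus the digit \<open>M\<close>, and at level 0 it vanishes on the half-open unit
  interval.\<close>

lemma floor_eq_if_bdigits_eq:
  assumes "u \<in> {0..<1}" "v \<in> {0..<1}" "\<And>k. k < M \<Longrightarrow> bdigit u k = bdigit v k"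
  shows "\<lfloor>2 ^ M * u\<rfloor> = \<lfloor>2 ^ M * v\<rfloor>"
  using assms(3)
proof (induction M)
  case 0
  have "\<lfloor>x\<rfloor> = 0" if "x \<in> {0..<1}" for x :: real using that by (simp add: floor_eq_iff)
  then show ?case using assms(1,2) by simp
next
  case (Suc M)
  have fl: "\<lfloor>2 ^ Suc M * x\<rfloor> = 2 * \<lfloor>2 ^ M * x\<rfloor> + of_bool (bdigit x M)" for x
  proof -
    define a b where "a = \<lfloor>2 ^ M * x\<rfloor>" and "b = \<lfloor>2 ^ Suc M * x\<rfloor>"
    have "of_int a \<le> 2 ^ M * x" "2 ^ M * x < of_int a + 1" unfolding a_def by linarith+
    moreover have "of_int b \<le> 2 * (2 ^ M * x)" "2 * (2 ^ M * x) < of_int b + 1"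
      unfolding b_def by (simp_all add: mult.assoc)
    ultimately have "b = 2 * a \<or> b = 2 * a + 1" by linarith
    then show ?thesis unfolding bdigit_def a_def[symmetric] b_def[symmetric] by auto
  qed
  have "\<lfloor>2 ^ M * u\<rfloor> = \<lfloor>2 ^ M * v\<rfloor>" using Suc by simp
  then show ?case unfolding fl using Suc.prems[of M] by simp
qed

text \<open>There are at most \<open>2 ^ card F\<close> digit patterns on \<open>F\<close>, and each
  leaves a single dyadic interval of length 1/2^M. Covering by a measurable \<open>V\<close> avoids
  the question whether \<open>S\<close> itself is measurable.\<close>

lemma bdigits_determined_cover:
  assumes S: "S \<subseteq> {0..<1}" and F: "finite F"
    and det: "\<And>u v k. u \<in> S \<Longrightarrow> v \<in> S \<Longrightarrow> (\<And>k. k \<in> F \<Longrightarrow> bdigit u k = bdigit v k) \<Longrightarrow>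
      k < M \<Longrightarrow> bdigit u k = bdigit v k"
  shows "\<exists>V\<in>sets lborel. S \<subseteq> V \<and> emeasure lborel V \<le> ennreal (2 ^ card F / 2 ^ M)"
proof -
  define \<Phi> where "\<Phi> u = {k \<in> F. bdigit u k}" for u
  define P where "P = (\<lambda>u. \<lfloor>2 ^ M * u\<rfloor>) ` S"
  \<comment> \<open>A representative of each pattern makes the floor a function of the pattern, so
    there are no more floors than patterns.\<close>
  have inv: "\<lfloor>2 ^ M * u\<rfloor> = \<lfloor>2 ^ M * inv_into S \<Phi> (\<Phi> u)\<rfloor>" if "u \<in> S" for u
  proof (rule floor_eq_if_bdigits_eq)
    let ?v = "inv_into S \<Phi> (\<Phi> u)"
    have v: "?v \<in> S" "\<Phi> ?v = \<Phi> u"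
      using inv_into_into[of "\<Phi> u" \<Phi> S] f_inv_into_f[of "\<Phi> u" \<Phi> S] that by auto
    show "u \<in> {0..<1}" "?v \<in> {0..<1}" using that v S by auto
    have "bdigit u k = bdigit ?v k" if "k \<in> F" for k using v(2) that unfolding \<Phi>_def by blast
    then show "bdigit u k = bdigit ?v k" if "k < M" for k using det[OF \<open>u \<in> S\<close> v(1)] that by blast
  qed
  have PF: "P = (\<lambda>A. \<lfloor>2 ^ M * inv_into S \<Phi> A\<rfloor>) ` (\<Phi> ` S)"
    unfolding P_def image_image using inv by (intro image_cong) auto
  have sub: "\<Phi> ` S \<subseteq> Pow F" by (auto simp: \<Phi>_def)
  have fin: "finite (\<Phi> ` S)" using sub F finite_subset by blast
  have finP: "finite P" unfolding PF using fin by simp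
  have "card P \<le> card (\<Phi> ` S)" unfolding PF by (rule card_image_le[OF fin])
  also have "\<dots> \<le> 2 ^ card F" using card_mono[OF _ sub] F by (simp add: card_Pow)
  finally have cP: "card P \<le> 2 ^ card F" .
  define I where "I p = {real_of_int p / 2 ^ M ..< (real_of_int p + 1) / 2 ^ M}" for p
  have "emeasure lborel (\<Union>p\<in>P. I p) \<le> (\<Sum>p\<in>P. emeasure lborel (I p))"
    by (rule emeasure_subadditive_finite) (auto simp: finP I_def)
  also have "\<dots> = (\<Sum>p\<in>P. ennreal (1 / 2 ^ M))"
    by (intro sum.cong) (auto simp: I_def divide_right_mono add_divide_distrib)
  also have "\<dots> = ennreal (real (card P) / 2 ^ M)"
    by (simp add: ennreal_of_nat_eq_real_of_nat ennreal_mult[symmetric])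
  also have "\<dots> \<le> ennreal (2 ^ card F / 2 ^ M)"
  proof (intro ennreal_leI divide_right_mono)
    show "real (card P) \<le> 2 ^ card F" using of_nat_mono[OF cP, where 'a = real] by simp
  qed simp
  finally have "emeasure lborel (\<Union>p\<in>P. I p) \<le> ennreal (2 ^ card F / 2 ^ M)" .
  moreover have "S \<subseteq> (\<Union>p\<in>P. I p)"
  proof
    fix u assume "u \<in> S"
    have "u \<in> I \<lfloor>2 ^ M * u\<rfloor>" unfolding I_def
      by (simp add: pos_divide_le_eq pos_less_divide_eq mult.commute)
    then show "u \<in> (\<Union>p\<in>P. I p)" using \<open>u \<in> S\<close> unfolding P_def by blast
  qed
  moreover have "(\<Union>p\<in>P. I p) \<in> sets lborel"
    using finP by (intro sets.finite_UN) (auto simp: I_def)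
  ultimately show ?thesis by blast
qed

text \<open>By the choice of \<open>d\<close>, the power of 1/2 equals \<open>\<rho> ^ k\<close>
  raised to \<open>d\<close>. Lowering the exponent to \<open>a\<close> frees a decaying factor
  \<open>q ^ k\<close>, which absorbs \<open>2 * real k + 1\<close> and the polynomial denominator
  of \<open>cgap\<close>.\<close>

lemma half_power_le_cgap_powr:
  assumes \<rho>: "0 < \<rho>" "\<rho> < 1" and d: "\<rho> powr d = 1/2" and a: "a < d"
  shows "\<exists>C>0. \<forall>k. (2 * real k + 1) * (1/2) ^ k \<le> C * cgap \<rho> k powr a"
proof -
  define q where "q = \<rho> powr (d - a)"
  have "0 < q" using \<rho> by (simp add: q_def)
  have "q < \<rho> powr 0" unfolding q_def using \<rho> a by (intro powr_less_mono') auto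
  then have "q < 1" using \<rho> by simp
  let ?f = "\<lambda>k::nat. (2 * real k + 1) * (2 * (real k + 1) * (real k + 2)) powr a * q ^ k"
  have "?f \<longlonglongrightarrow> 0" using \<open>0 < q\<close> \<open>q < 1\<close> by real_asymp
  then have "Bseq ?f" by (intro convergent_imp_Bseq convergentI)
  then obtain C where C: "0 < C" "\<And>k. norm (?f k) \<le> C" by (auto elim: BseqE)
  have "(2 * real k + 1) * (1/2) ^ k \<le> C * cgap \<rho> k powr a" for k
  proof -
    have pow: "(\<rho> powr x) ^ k = (\<rho> ^ k) powr x" for x
      using \<rho> by (simp add: powr_powr mult.commute flip: powr_realpow)
    have g: "cgap \<rho> k powr a = (\<rho> powr a) ^ k / (2 * (real k + 1) * (real k + 2)) powr a"
      unfolding cgap_def pow by (rule powr_divide)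
    have "(1/2) ^ k = q ^ k * (\<rho> powr a) ^ k"
      unfolding q_def power_mult_distrib[symmetric] powr_add[symmetric] by (simp add: d)
    then have "(2 * real k + 1) * (1/2) ^ k = ?f k * cgap \<rho> k powr a"
      by (simp add: g)
    also have "\<dots> \<le> C * cgap \<rho> k powr a"
      using C(2)[of k] by (intro mult_right_mono) auto
    finally show ?thesis .
  qed
  with C(1) show ?thesis by blast
qed

context cantor_digits
begin

text \<open>\<open>ctail \<rho> (\<kappa> j)\<close> bounds the distance of points whose digits
  agree below level \<open>\<kappa> j\<close>. If they differ there, \<open>osc\<close> jumps by at
  least \<open>cgap (1/2) j\<close>, and \<open>w\<close> may cancel only half of that.\<close>

definition slowly_varying :: "(real \<Rightarrow> real) \<Rightarrow> nat \<Rightarrow> bool" where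
  "slowly_varying w j0 \<longleftrightarrow> (\<forall>j\<ge>j0. \<forall>x\<in>{0..1}. \<forall>y\<in>{0..1}.
     \<bar>x - y\<bar> \<le> ctail \<rho> (\<kappa> j) \<longrightarrow> \<bar>w x - w y\<bar> \<le> cgap (1/2) j / 2)"

text \<open>Uniformly distributed binary digits carry Lebesgue measure on $[0,1)$ to the natural measure on
  the graph over the Cantor set. The factor $2k + 1$ accounts for the
  levels \<open>\<kappa> j < k\<close>, at most $1 + \log_2 k$ of them, which are already fixed by the
  position of $x$.\<close>

lemma bdigit_set_small:
  assumes \<kappa>: "strict_mono \<kappa>" "\<And>j. 2 ^ j \<le> \<kappa> j" and w: "slowly_varying w j0"
    and k: "\<And>i. i < k \<Longrightarrow> r < cgap \<rho> i" and m: "\<And>j. j < m \<Longrightarrow> r < cgap (1/2) j / 2"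
    and U: "\<And>y z. y \<in> U \<Longrightarrow> z \<in> U \<Longrightarrow> dist y z \<le> r"
  defines "S \<equiv> {u \<in> {0..<1}. (cpoint \<rho> (bdigit u), w (cpoint \<rho> (bdigit u)) + osc (cpoint \<rho> (bdigit u))) \<in> U}"
  shows "\<exists>V\<in>sets lborel. S \<subseteq> V \<and> emeasure lborel V \<le> ennreal (2 ^ j0 * ((2 * real k + 1) * (1/2) ^ k) * (1/2) ^ m)"
proof -
  \<comment> \<open>Levels \<open>\<kappa> j\<close> with \<open>j < i0\<close> lie below
    \<open>k\<close> and bring no new information. The growth of \<open>\<kappa>\<close> keeps
    \<open>2 ^ i0\<close> linear in \<open>k\<close>; the summand 1 in the bound covers
    \<open>i0 = 0\<close>.\<close>
  define i0 where "i0 = (LEAST j. k \<le> \<kappa> j)"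
  have "k \<le> \<kappa> k" using \<kappa>(1) by (rule strict_mono_imp_increasing)
  then have i0: "k \<le> \<kappa> i0" unfolding i0_def by (rule LeastI)
  have i0_le: "2 ^ i0 \<le> 2 * k + 1"
  proof (cases i0)
    case (Suc i)
    then have "\<not> k \<le> \<kappa> i" using not_less_Least[of i "\<lambda>j. k \<le> \<kappa> j"] unfolding i0_def by simp
    then have "2 ^ i \<le> k" using \<kappa>(2)[of i] by linarith
    then show ?thesis using Suc by simp
  qed simp
  \<comment> \<open>The digits at the levels \<open>\<kappa> j\<close> with \<open>j\<close> in
    \<open>J\<close> are read off the value of the function: the position has not fixed them,
    \<open>w\<close> varies slowly enough, and scale \<open>r\<close> resolves them.
    \<open>F\<close> holds the remaining free levels below \<open>M\<close>.\<close>
  define J where "J = {i0 + j0..<m}"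
  define M where "M = max k (\<kappa> m)"
  define F where "F = {k..<M} - \<kappa> ` J"
  have det: "bdigit u p = bdigit v p"
    if uv: "u \<in> S" "v \<in> S" and F: "\<And>p. p \<in> F \<Longrightarrow> bdigit u p = bdigit v p" and p: "p < M" for u v p
  proof (rule ccontr)
    assume "bdigit u p \<noteq> bdigit v p"
    define e e' where "e = bdigit u" and "e' = bdigit v"
    define l where "l = (LEAST l. e l \<noteq> e' l)"
    have "e p \<noteq> e' p" using \<open>bdigit u p \<noteq> bdigit v p\<close> by (simp add: e_def e'_def)
    then have l: "e l \<noteq> e' l" "l \<le> p" unfolding l_def by (rule LeastI, rule Least_le)
    have below: "e i = e' i" if "i < l" for i using that not_less_Least unfolding l_def by blast
    let ?f = "\<lambda>e. w (cpoint \<rho> e) + osc (cpoint \<rho> e)"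
    have "dist (cpoint \<rho> e, ?f e) (cpoint \<rho> e', ?f e') \<le> r"
      using uv U unfolding S_def e_def e'_def by blast
    then have dx: "\<bar>cpoint \<rho> e - cpoint \<rho> e'\<bar> \<le> r" and df: "\<bar>?f e - ?f e'\<bar> \<le> r"
      using dist_fst_le[of "(cpoint \<rho> e, ?f e)" "(cpoint \<rho> e', ?f e')"]
        dist_snd_le[of "(cpoint \<rho> e, ?f e)" "(cpoint \<rho> e', ?f e')"] by (simp_all add: dist_real_def)
    have "cgap \<rho> l \<le> \<bar>cpoint \<rho> e - cpoint \<rho> e'\<bar>" using below l(1) by (rule cpoint_separated)
    then have "k \<le> l" using k[of l] dx by fastforce
    moreover have "l \<notin> F" using F[of l] l(1) by (auto simp: e_def e'_def)
    ultimately have "l \<in> \<kappa> ` J" using l(2) p by (simp add: F_def)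
    then obtain j where j: "l = \<kappa> j" "i0 + j0 \<le> j" "j < m" by (auto simp: J_def)
    \<comment> \<open>The first difference is at level \<open>\<kappa> j\<close>, so the digit
      sequences of the two values of \<open>osc\<close> first differ at \<open>j\<close>.\<close>
    have "cgap (1/2) j \<le> \<bar>cpoint (1/2) (\<lambda>j. e (\<kappa> j)) - cpoint (1/2) (\<lambda>j. e' (\<kappa> j))\<bar>"
    proof (rule half.cpoint_separated)
      show "e (\<kappa> i) = e' (\<kappa> i)" if "i < j" for i
        using below j(1) strict_monoD[OF \<kappa>(1) that] by simp
    qed (use l j in simp)
    moreover have "\<bar>w (cpoint \<rho> e) - w (cpoint \<rho> e')\<bar> \<le> cgap (1/2) j / 2"
    proof -
      have "\<bar>cpoint \<rho> e - cpoint \<rho> e'\<bar> \<le> ctail \<rho> (\<kappa> j)" using below unfolding j(1) by (rule cpoint_agree)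
      then show ?thesis using w j(2) cpoint_range unfolding slowly_varying_def by simp
    qed
    ultimately have "cgap (1/2) j / 2 \<le> r" using df unfolding osc_cpoint by linarith
    then show False using m[OF j(3)] by simp
  qed
  have "\<exists>V\<in>sets lborel. S \<subseteq> V \<and> emeasure lborel V \<le> ennreal (2 ^ card F / 2 ^ M)"
  proof (rule bdigits_determined_cover)
    show "S \<subseteq> {0..<1}" unfolding S_def by blast
    show "finite F" by (simp add: F_def)
  qed (rule det)
  moreover have "(2::real) ^ card F / 2 ^ M \<le> 2 ^ j0 * ((2 * real k + 1) * (1/2) ^ k) * (1/2) ^ m"
  proof -
    have inj: "inj_on \<kappa> J" using \<kappa>(1) strict_mono_eq by (auto intro: inj_onI)
    have sub: "\<kappa> ` J \<subseteq> {k..<M}"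
    proof
      fix l assume "l \<in> \<kappa> ` J"
      then obtain j where j: "l = \<kappa> j" "i0 \<le> j" "j < m" by (auto simp: J_def)
      then have "\<kappa> i0 \<le> l" "l < \<kappa> m" using \<kappa>(1) by (simp_all add: strict_mono_less strict_mono_less_eq)
      then show "l \<in> {k..<M}" using i0 by (auto simp: M_def)
    qed
    \<comment> \<open>The subtraction is truncated: for \<open>m \<le> i0 + j0\<close> the set
      \<open>J\<close> is empty, and the inequality drawn from this equation still holds.\<close>
    have "card F + (m - (i0 + j0)) = M - k"
      using card_Diff_subset[OF _ sub] card_mono[OF _ sub] card_image[OF inj] by (simp add: F_def J_def)
    then have "card F + k + m \<le> M + i0 + j0" by (simp add: M_def)
    then have "(2::real) ^ (card F + k + m) \<le> 2 ^ (M + i0 + j0)" by (intro power_increasing) auto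
    also have "\<dots> = 2 ^ (M + j0) * 2 ^ i0" by (simp add: power_add)
    also have "\<dots> \<le> 2 ^ (M + j0) * (2 * real k + 1)"
      using of_nat_mono[OF i0_le, where 'a = real] by (intro mult_left_mono) auto
    finally show ?thesis by (simp add: power_add power_one_over field_simps)
  qed
  ultimately show ?thesis by (meson ennreal_leI order.trans)
qed

text \<open>Mass distribution principle: if sets of diameter at most \<open>r\<close> have mass at
  most \<open>C * r powr t\<close>, then a cover of too small total cost cannot carry the full mass
  1.\<close>

lemma not_hnull_graph_add_osc:
  assumes \<kappa>: "strict_mono \<kappa>" "\<And>j. 2 ^ j \<le> \<kappa> j" and w: "slowly_varying w j0"
    and d: "\<rho> powr d = 1/2" "0 < d" and t: "0 < t" "t < 1 + d"
  shows "\<not> hnull t (graph_on (\<lambda>x. w x + osc x) {0..1})"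
proof
  assume null: "hnull t (graph_on (\<lambda>x. w x + osc x) {0..1})"
  \<comment> \<open>The exponent \<open>t\<close> is split in the ratio of the dimensions
    \<open>d\<close> of the Cantor set and 1 of the values; both parts stay strictly below their
    dimension, as \<open>half_power_le_cgap_powr\<close> requires.\<close>
  define a b where "a = t * d / (1 + d)" and "b = t / (1 + d)"
  have ab: "0 \<le> a" "a < d" "0 \<le> b" "b < 1" "a + b = t"
  proof -
    show "0 \<le> a" "0 \<le> b" using t d by (auto simp: a_def b_def)
    show "b < 1" using t d by (simp add: b_def)
    have "a = b * d" by (simp add: a_def b_def)
    then show "a < d" using \<open>b < 1\<close> d by simp
    have "a + b = b * (1 + d)" using \<open>a = b * d\<close> by (simp add: distrib_left)
    then show "a + b = t" using d by (simp add: b_def)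
  qed
  obtain C1 where C1: "0 < C1" "\<And>k. (2 * real k + 1) * (1/2) ^ k \<le> C1 * cgap \<rho> k powr a"
    using half_power_le_cgap_powr[of \<rho> d a] \<rho> d ab by auto
  obtain C2 where C2: "0 < C2" "\<And>k. (2 * real k + 1) * (1/2) ^ k \<le> C2 * cgap (1/2) k powr b"
    using half_power_le_cgap_powr[of "1/2" 1 b] ab by auto
  define C where "C = 2 ^ j0 * C1 * (C2 * 2 powr b)"
  have "0 < C" using C1 C2 by (simp add: C_def)
  let ?z = "\<lambda>u. (cpoint \<rho> (bdigit u), w (cpoint \<rho> (bdigit u)) + osc (cpoint \<rho> (bdigit u)))"
  have small: "\<exists>V\<in>sets lborel. {u \<in> {0..<1}. ?z u \<in> U} \<subseteq> V \<and> emeasure lborel V \<le> ennreal (C * r powr t)"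
    if r: "0 < r" and U: "\<And>y z. y \<in> U \<Longrightarrow> z \<in> U \<Longrightarrow> dist y z \<le> r" for r U
  proof -
    \<comment> \<open>\<open>k\<close> and \<open>m\<close> count the digits that scale
      \<open>r\<close> resolves by position and by value. Minimality gives the lower bounds on
      earlier gaps; the gaps at \<open>k\<close> and \<open>m\<close> turn powers of 1/2 into powers
      of \<open>r\<close>.\<close>
    define k where "k = (LEAST k. cgap \<rho> k \<le> r)"
    define m where "m = (LEAST m. cgap (1/2) m / 2 \<le> r)"
    have "\<exists>k. cgap \<rho> k \<le> r"
      using order_tendstoD(2)[OF cgap_tendsto_0 r] by (auto simp: eventually_sequentially intro: less_imp_le)
    then have k: "cgap \<rho> k \<le> r" unfolding k_def by (rule LeastI_ex)
    have "\<exists>m. cgap (1/2) m < r"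
      using order_tendstoD(2)[OF half.cgap_tendsto_0 r] by (auto simp: eventually_sequentially)
    then obtain m' where "cgap (1/2) m' < r" by blast
    then have "cgap (1/2) m' / 2 \<le> r" using r by simp
    then have m: "cgap (1/2) m / 2 \<le> r" unfolding m_def by (rule LeastI)
    have "\<exists>V\<in>sets lborel. {u \<in> {0..<1}. ?z u \<in> U} \<subseteq> V \<and>
        emeasure lborel V \<le> ennreal (2 ^ j0 * ((2 * real k + 1) * (1/2) ^ k) * (1/2) ^ m)"
    proof (rule bdigit_set_small[OF \<kappa> w _ _ U])
      show "r < cgap \<rho> i" if "i < k" for i using not_less_Least[OF that[unfolded k_def]] by simp
      show "r < cgap (1/2) j / 2" if "j < m" for j using not_less_Least[OF that[unfolded m_def]] by simp
    qed
    moreover have "2 ^ j0 * ((2 * real k + 1) * (1/2) ^ k) * (1/2) ^ m \<le> C * r powr t"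
    proof -
      have 1: "(2 * real k + 1) * (1/2) ^ k \<le> C1 * r powr a"
        using C1(2)[of k] k ab(1) C1(1) cgap_pos[of k]
        by (elim order.trans) (auto intro!: mult_left_mono powr_mono2)
      have "(1/2) ^ m \<le> (2 * real m + 1) * (1/2::real) ^ m" by (simp add: mult_le_cancel_right1)
      also have "\<dots> \<le> C2 * cgap (1/2) m powr b" by (rule C2(2))
      also have "\<dots> \<le> C2 * (2 * r) powr b"
        using m ab(3) C2(1) half.cgap_pos[of m] by (auto intro!: mult_left_mono powr_mono2)
      also have "\<dots> = C2 * 2 powr b * r powr b" using r by (simp add: powr_mult)
      finally have 2: "(1/2) ^ m \<le> C2 * 2 powr b * r powr b" .
      have "2 ^ j0 * ((2 * real k + 1) * (1/2) ^ k) * (1/2) ^ m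
          \<le> 2 ^ j0 * (C1 * r powr a) * (C2 * 2 powr b * r powr b)"
        using C1(1) by (intro mult_mono 1 2) auto
      also have "\<dots> = C * (r powr a * r powr b)" by (simp add: C_def)
      also have "r powr a * r powr b = r powr t" using ab(5) by (simp flip: powr_add)
      finally show ?thesis .
    qed
    ultimately show ?thesis by (meson ennreal_leI order.trans)
  qed
  have "0 < 1 / (4 * C)" using \<open>0 < C\<close> by simp
  then obtain U where U: "graph_on (\<lambda>x. w x + osc x) {0..1} \<subseteq> (\<Union>i. U i)" "\<And>i. bounded (U i)"
    "(\<Sum>i. ennreal (diameter (U i) powr t)) < ennreal (1 / (4 * C))"
    using null unfolding hnull_def by blast
  \<comment> \<open>\<open>small\<close> needs a positive radius, so sets of diameter 0 receive one
    at a summable extra cost. All extras together are 1/(4C), which keeps the total mass at most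
    1/2.\<close>
  have "\<exists>r. 0 < r \<and> diameter (U i) \<le> r \<and> r powr t \<le> diameter (U i) powr t + 1 / (4 * C) * (1/2) ^ Suc i" for i
  proof (cases "diameter (U i) = 0")
    case True
    define h where "h = 1 / (4 * C) * (1/2) ^ Suc i"
    have "0 < h" using \<open>0 < C\<close> by (simp add: h_def)
    then have "(h powr (1 / t)) powr t = h" using t by (simp add: powr_powr)
    then show ?thesis using True \<open>0 < h\<close> t unfolding h_def[symmetric]
      by (intro exI[of _ "h powr (1 / t)"]) simp
  next
    case False
    then show ?thesis using diameter_ge_0[OF U(2)[of i]] \<open>0 < C\<close>
      by (intro exI[of _ "diameter (U i)"]) auto
  qed
  then obtain r where r: "\<And>i. 0 < r i" "\<And>i. diameter (U i) \<le> r i"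
    "\<And>i. r i powr t \<le> diameter (U i) powr t + 1 / (4 * C) * (1/2) ^ Suc i" by metis
  have "\<exists>V. V \<in> sets lborel \<and> {u \<in> {0..<1}. ?z u \<in> U i} \<subseteq> V \<and> emeasure lborel V \<le> ennreal (C * r i powr t)" for i
  proof -
    have "dist y z \<le> r i" if "y \<in> U i" "z \<in> U i" for y z
      using diameter_bounded_bound[OF U(2) that] r(2) by (rule order.trans)
    from small[OF r(1) this] show ?thesis by blast
  qed
  then have "\<forall>i. \<exists>V. V \<in> sets lborel \<and> {u \<in> {0..<1}. ?z u \<in> U i} \<subseteq> V \<and>
      emeasure lborel V \<le> ennreal (C * r i powr t)" by (rule allI)
  from choice[OF this] obtain V where V: "\<And>i. V i \<in> sets lborel" "\<And>i. {u \<in> {0..<1}. ?z u \<in> U i} \<subseteq> V i"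
    "\<And>i. emeasure lborel (V i) \<le> ennreal (C * r i powr t)" by auto
  have "{0..<1} \<subseteq> (\<Union>i. V i)"
  proof
    fix u :: real assume u: "u \<in> {0..<1}"
    have "?z u \<in> graph_on (\<lambda>x. w x + osc x) {0..1}"
      using cpoint_range unfolding graph_on_def by blast
    then obtain i where "?z u \<in> U i" using U(1) by blast
    then show "u \<in> (\<Union>i. V i)" using u V(2) by blast
  qed
  then have "emeasure lborel {0..<1::real} \<le> emeasure lborel (\<Union>i. V i)"
    using V(1) by (intro emeasure_mono sets.countable_UN) auto
  also have "\<dots> \<le> (\<Sum>i. emeasure lborel (V i))"
    using V(1) by (intro emeasure_subadditive_countably) auto
  also have "\<dots> \<le> (\<Sum>i. ennreal C * (ennreal (diameter (U i) powr t) + ennreal (1 / (4 * C) * (1/2) ^ Suc i)))"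
  proof (intro suminf_le)
    fix i
    have "C * r i powr t \<le> C * (diameter (U i) powr t + 1 / (4 * C) * (1/2) ^ Suc i)"
      using r(3) \<open>0 < C\<close> by (intro mult_left_mono) auto
    then have "ennreal (C * r i powr t) \<le> ennreal (C * (diameter (U i) powr t + 1 / (4 * C) * (1/2) ^ Suc i))"
      by (rule ennreal_leI)
    also have "\<dots> = ennreal C * (ennreal (diameter (U i) powr t) + ennreal (1 / (4 * C) * (1/2) ^ Suc i))"
    proof -
      have "ennreal (C * (x + y)) = ennreal C * (ennreal x + ennreal y)" if "0 \<le> x" "0 \<le> y" for x y
        using that \<open>0 < C\<close> by (simp add: ennreal_mult)
      then show ?thesis using \<open>0 < C\<close> by simp
    qed
    finally have "ennreal (C * r i powr t)
        \<le> ennreal C * (ennreal (diameter (U i) powr t) + ennreal (1 / (4 * C) * (1/2) ^ Suc i))" .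
    with V(3)[of i] show "emeasure lborel (V i)
        \<le> ennreal C * (ennreal (diameter (U i) powr t) + ennreal (1 / (4 * C) * (1/2) ^ Suc i))"
      by (rule order.trans)
  qed auto
  also have "\<dots> = ennreal C * ((\<Sum>i. ennreal (diameter (U i) powr t)) + (\<Sum>i. ennreal (1 / (4 * C) * (1/2) ^ Suc i)))"
    by (simp only: ennreal_suminf_cmult suminf_add[OF summableI summableI])
  also have "(\<Sum>i. ennreal (1 / (4 * C) * (1/2) ^ Suc i)) = ennreal (1 / (4 * C))"
  proof -
    have s: "(\<lambda>i. 1 / (4 * C) * (1/2::real) ^ Suc i) sums (1 / (4 * C) * 1)"
      by (intro sums_mult power_half_series)
    have "(\<Sum>i. ennreal (1 / (4 * C) * (1/2) ^ Suc i)) = ennreal (1 / (4 * C) * 1)"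
      using \<open>0 < C\<close> by (intro suminf_ennreal_eq s) simp
    then show ?thesis by (simp only: mult_1_right)
  qed
  also have "ennreal C * ((\<Sum>i. ennreal (diameter (U i) powr t)) + ennreal (1 / (4 * C)))
      \<le> ennreal C * (ennreal (1 / (4 * C)) + ennreal (1 / (4 * C)))"
    using U(3) by (intro mult_left_mono add_mono) auto
  also have "\<dots> = ennreal (1/2)"
    using \<open>0 < C\<close> by (subst ennreal_plus[symmetric]) (auto simp: ennreal_mult[symmetric])
  finally have "ennreal 1 \<le> ennreal (1/2)" by simp
  then show False by (subst (asm) ennreal_le_iff) auto
qed

end

subsection \<open>Extending subspaces\<close>

text \<open>Uniform continuity of finitely many functions makes every large level admissible for a
  given \<open>j\<close>. The divisor \<open>real j + 1\<close> is there to absorb the coefficients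
  of linear combinations later.\<close>

lemma (in cantor_ratio) ex_rapid_levels:
  assumes B: "finite B" "\<And>b. b \<in> B \<Longrightarrow> continuous_on {0..1} b"
  shows "\<exists>\<kappa>. strict_mono \<kappa> \<and> (\<forall>j. 2 ^ j \<le> \<kappa> j) \<and> (\<forall>j. \<forall>b\<in>B. \<forall>x\<in>{0..1}. \<forall>y\<in>{0..1}.
     \<bar>x - y\<bar> \<le> ctail \<rho> (\<kappa> j) \<longrightarrow> \<bar>b x - b y\<bar> \<le> cgap (1/2) j / (real j + 1))"
proof -
  let ?P = "\<lambda>j n. \<forall>b\<in>B. \<forall>x\<in>{0..1}. \<forall>y\<in>{0..1}. \<bar>x - y\<bar> \<le> ctail \<rho> n \<longrightarrow> \<bar>b x - b y\<bar> \<le> cgap (1/2) j / (real j + 1)"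
  have "eventually (?P j) sequentially" for j
  proof (subst eventually_ball_finite_distrib[OF B(1)], intro ballI)
    fix b assume "b \<in> B"
    then have "uniformly_continuous_on {0..1} b" using B(2) by (intro compact_uniformly_continuous) auto
    moreover have "0 < cgap (1/2) j / (real j + 1)" using half.cgap_pos[of j] by simp
    ultimately obtain d where d: "0 < d" "\<And>x y. x \<in> {0..1} \<Longrightarrow> y \<in> {0..1} \<Longrightarrow> dist y x < d \<Longrightarrow>
        dist (b y) (b x) < cgap (1/2) j / (real j + 1)"
      unfolding uniformly_continuous_on_def by metis
    have "\<forall>\<^sub>F n in sequentially. ctail \<rho> n < d" using order_tendstoD(2)[OF ctail_tendsto_0 d(1)] .
    then show "\<forall>\<^sub>F n in sequentially. \<forall>x\<in>{0..1}. \<forall>y\<in>{0..1}. \<bar>x - y\<bar> \<le> ctail \<rho> n \<longrightarrow>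
        \<bar>b x - b y\<bar> \<le> cgap (1/2) j / (real j + 1)"
    proof eventually_elim
      case (elim n)
      then show ?case using d(2) unfolding dist_real_def by (meson less_imp_le order.strict_trans1)
    qed
  qed
  then obtain N where N: "\<And>j n. N j \<le> n \<Longrightarrow> ?P j n" unfolding eventually_sequentially by metis
  \<comment> \<open>Partial sums of positive terms dominate each term and increase strictly.\<close>
  define \<kappa> where "\<kappa> j = (\<Sum>i\<le>j. N i + 2 ^ i)" for j
  have "N j + 2 ^ j \<le> \<kappa> j" for j
    unfolding \<kappa>_def by (rule member_le_sum[of j "{..j}" "\<lambda>i. N i + 2 ^ i"]) auto
  then have "2 ^ j \<le> \<kappa> j" "N j \<le> \<kappa> j" for j using add_leE by blast+
  moreover have "strict_mono \<kappa>" unfolding strict_mono_Suc_iff \<kappa>_def by simp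
  ultimately show ?thesis using N by blast
qed

lemma sum_fun_apply: "(\<Sum>a\<in>A. f a) x = (\<Sum>a\<in>A. f a x)"
  by (induction A rule: infinite_finite_induct) auto

interpretation fs: vector_space fscale
  by unfold_locales (auto simp: fscale_def fun_eq_iff algebra_simps)

text \<open>The divisor \<open>real j + 1\<close> outgrows twice the sum of the absolute
  coefficients, so one choice of \<open>\<kappa>\<close> serves the whole span and only
  \<open>j0\<close> depends on \<open>w\<close>.\<close>

lemma (in cantor_digits) ex_slowly_varying:
  assumes B: "finite B" and w: "w \<in> fs.span B"
    and \<kappa>: "\<And>j b x y. b \<in> B \<Longrightarrow> x \<in> {0..1} \<Longrightarrow> y \<in> {0..1} \<Longrightarrow> \<bar>x - y\<bar> \<le> ctail \<rho> (\<kappa> j) \<Longrightarrow>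
      \<bar>b x - b y\<bar> \<le> cgap (1/2) j / (real j + 1)"
  shows "\<exists>j0. slowly_varying w j0"
proof -
  obtain c where "w = (\<Sum>b\<in>B. fscale (c b) b)" using w unfolding fs.span_finite[OF B] by blast
  then have wx: "w x = (\<Sum>b\<in>B. c b * b x)" for x by (simp add: sum_fun_apply fscale_def)
  define K where "K = (\<Sum>b\<in>B. \<bar>c b\<bar>)"
  obtain j0 :: nat where j0: "2 * K \<le> real j0" using real_arch_simple by blast
  have "\<bar>w x - w y\<bar> \<le> cgap (1/2) j / 2"
    if "j0 \<le> j" "x \<in> {0..1}" "y \<in> {0..1}" "\<bar>x - y\<bar> \<le> ctail \<rho> (\<kappa> j)" for j x y
  proof -
    have "\<bar>w x - w y\<bar> = \<bar>\<Sum>b\<in>B. c b * (b x - b y)\<bar>"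
      by (simp add: wx sum_subtractf right_diff_distrib)
    also have "\<dots> \<le> (\<Sum>b\<in>B. \<bar>c b * (b x - b y)\<bar>)" by (rule sum_abs)
    also have "\<dots> \<le> (\<Sum>b\<in>B. \<bar>c b\<bar> * (cgap (1/2) j / (real j + 1)))"
      unfolding abs_mult using \<kappa> that by (intro sum_mono mult_left_mono) auto
    also have "\<dots> = K * (cgap (1/2) j / (real j + 1))" unfolding K_def by (rule sum_distrib_right[symmetric])
    also have "\<dots> \<le> ((real j + 1) / 2) * (cgap (1/2) j / (real j + 1))"
      using j0 that(1) half.cgap_pos[of j] by (intro mult_right_mono) auto
    also have "\<dots> = cgap (1/2) j / 2" by (simp add: field_simps)
    finally show ?thesis .
  qed
  then show ?thesis unfolding slowly_varying_def by blast
qed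

section \<open>Null graphs of the functions to be combined\<close>

lemma hnull_graph_0:
  assumes "1 < t"
  shows "hnull t (graph_on 0 {0..1})"
proof -
  have "1-lipschitz_on {0..1} (\<lambda>x::real. (x, 0::real))"
    by (intro lipschitz_onI) (auto simp: dist_Pair_Pair)
  then have "hnull t ((\<lambda>x::real. (x, 0::real)) ` {0..1})"
    using hnull_unit_interval assms by (intro hnull_lipschitz_image) auto
  then show ?thesis by (simp add: graph_on_def)
qed

text \<open>Applied with factor 1/c, it normalises the coefficient of \<open>osc\<close> to 1 in the
  lower bound.\<close>

lemma hnull_graph_scale:
  assumes "hnull t (graph_on f X)" "0 \<le> t"
  shows "hnull t (graph_on (\<lambda>x. c * f x) X)"
proof -
  let ?h = "\<lambda>z::real\<times>real. (fst z, c * snd z)"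
  have "(1 + \<bar>c\<bar>)-lipschitz_on (graph_on f X) ?h"
  proof (rule lipschitz_onI)
    fix z z' :: "real \<times> real"
    have "dist (?h z) (?h z') \<le> \<bar>fst z - fst z'\<bar> + \<bar>c * snd z - c * snd z'\<bar>"
      using sqrt_sum_squares_le_sum_abs by (simp add: dist_prod_def dist_real_def)
    also have "\<dots> = dist (fst z) (fst z') + \<bar>c\<bar> * dist (snd z) (snd z')"
      by (simp add: abs_mult[symmetric] right_diff_distrib dist_real_def)
    also have "\<dots> \<le> dist z z' + \<bar>c\<bar> * dist z z'"
      by (intro add_mono mult_left_mono dist_fst_le dist_snd_le) simp
    finally show "dist (?h z) (?h z') \<le> (1 + \<bar>c\<bar>) * dist z z'" by (simp add: distrib_right)
  qed simp
  then have "hnull t (?h ` graph_on f X)" using assms by (intro hnull_lipschitz_image)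
  then show ?thesis by (simp add: graph_on_def image_image)
qed

lemma hnull_graph_H_s:
  assumes "f \<in> H_s s \<union> {0}" "1 < s" "s < t"
  shows "hnull t (graph_on f {0..1})"
proof (cases "f = 0")
  case True
  then show ?thesis using hnull_graph_0 assms by simp
next
  case False
  then have f: "f \<in> C01" "hausdorff_dim (graph_on f {0..1}) = s" using assms by (auto simp: H_s_def)
  then have "hnull 3 (graph_on f {0..1})" by (intro hnull_graph_above_2) (auto simp: C01_def)
  then have "{t. 0 \<le> t \<and> hnull t (graph_on f {0..1})} \<noteq> {}" by force
  then show ?thesis using f(2) assms(3) by (intro hnull_if_dim_less) auto
qed

lemma span_H_s_extend:
  assumes s: "1 < s" "s \<le> 2" and B: "finite B" "fs.span B \<subseteq> H_s s \<union> {0}"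
  shows "\<exists>g. g \<notin> fs.span B \<and> fs.span (insert g B) \<subseteq> H_s s \<union> {0}"
proof -
  \<comment> \<open>This ratio solves \<open>\<rho> powr (s - 1) = 1/2\<close>, so the Cantor set
    has dimension \<open>s - 1\<close>; at \<open>s = 2\<close> it is exactly 1/2.\<close>
  define \<rho> :: real where "\<rho> = (1/2) powr (1 / (s - 1))"
  have "\<rho> \<le> (1/2) powr 1" unfolding \<rho>_def using s by (intro powr_mono') auto
  then have \<rho>: "0 < \<rho>" "\<rho> \<le> 1/2" by (simp_all add: \<rho>_def)
  have \<rho>s: "\<rho> powr (s - 1) = 1/2" using s by (simp add: \<rho>_def powr_powr)
  interpret cantor_ratio \<rho> using \<rho> by unfold_locales
  have C01: "w \<in> C01" if "w \<in> fs.span B" for w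
    using that B(2) by (auto simp: H_s_def C01_def)
  have cont: "continuous_on {0..1} b" if "b \<in> B" for b
    using C01[OF fs.span_base[OF that]] by (simp add: C01_def)
  obtain \<kappa> where \<kappa>: "strict_mono \<kappa>" "\<And>j. 2 ^ j \<le> \<kappa> j"
    "\<And>j b x y. b \<in> B \<Longrightarrow> x \<in> {0..1} \<Longrightarrow> y \<in> {0..1} \<Longrightarrow> \<bar>x - y\<bar> \<le> ctail \<rho> (\<kappa> j) \<Longrightarrow>
      \<bar>b x - b y\<bar> \<le> cgap (1/2) j / (real j + 1)"
    using ex_rapid_levels[OF B(1) cont] by blast
  interpret cantor_digits \<rho> \<kappa> by unfold_locales
  define g where "g x = (if x \<in> {0..1} then osc x else 0)" for x
  have "continuous_on {0..1} g"
    using continuous_on_osc by (rule continuous_on_eq) (simp add: g_def)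
  then have gC: "g \<in> C01" by (simp add: C01_def g_def)
  have graph: "graph_on (w + fscale c g) {0..1} = graph_on (\<lambda>x. w x + c * osc x) {0..1}" for w c
    by (auto simp: graph_on_def g_def fscale_def)
  have lower: "\<not> hnull t (graph_on (w + fscale c g) {0..1})"
    if w: "w \<in> fs.span B" and c: "c \<noteq> 0" and t: "0 \<le> t" "t < s" for w c t
  proof
    assume "hnull t (graph_on (w + fscale c g) {0..1})"
    \<comment> \<open>\<open>not_hnull_graph_add_osc\<close> needs a positive exponent; since
      \<open>1 < s\<close>, the maximum is still below \<open>s\<close>.\<close>
    then have "hnull (max t 1) (graph_on (w + fscale c g) {0..1})"
      using t(1) by (rule hnull_mono) simp
    then have "hnull (max t 1) (graph_on (\<lambda>x. w x + c * osc x) {0..1})" by (simp only: graph)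
    then have "hnull (max t 1) (graph_on (\<lambda>x. (1 / c) * (w x + c * osc x)) {0..1})"
      by (rule hnull_graph_scale) simp
    moreover have "(1 / c) * (w x + c * osc x) = fscale (1 / c) w x + osc x" for x
      using c by (simp add: fscale_def distrib_left)
    ultimately have null: "hnull (max t 1) (graph_on (\<lambda>x. fscale (1 / c) w x + osc x) {0..1})"
      by (simp only:)
    have "\<exists>j0. slowly_varying (fscale (1 / c) w) j0"
      by (rule ex_slowly_varying[OF B(1) fs.span_scale[OF w]]) (rule \<kappa>(3))
    then obtain j0 where "slowly_varying (fscale (1 / c) w) j0" by blast
    then have "\<not> hnull (max t 1) (graph_on (\<lambda>x. fscale (1 / c) w x + osc x) {0..1})"
      using s t by (intro not_hnull_graph_add_osc[OF \<kappa>(1,2) _ \<rho>s]) simp_all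
    with null show False by contradiction
  qed
  have mem: "w + fscale c g \<in> H_s s" if w: "w \<in> fs.span B" and c: "c \<noteq> 0" for w c
  proof -
    have "w + fscale c g \<in> C01"
      using C01[OF w] gC by (auto simp: C01_def fscale_def plus_fun_def intro!: continuous_intros)
    moreover have "hausdorff_dim (graph_on (w + fscale c g) {0..1}) = s"
    proof (rule hausdorff_dim_eqI)
      fix t assume t: "s < t"
      have "\<rho> powr (t - 1) < \<rho> powr (s - 1)" using \<rho> t by (intro powr_less_mono') auto
      then have "2 * \<rho> powr (t - 1) < 1" using \<rho>s by simp
      moreover have "hnull t (graph_on w {0..1})" using w B(2) s t by (intro hnull_graph_H_s) auto
      moreover have "continuous_on {0..1} w" using C01[OF w] by (simp add: C01_def)
      ultimately show "hnull t (graph_on (w + fscale c g) {0..1})"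
        unfolding graph using s t by (intro hnull_graph_add_osc) auto
    qed (use s lower w c in auto)
    ultimately show ?thesis by (simp add: H_s_def)
  qed
  have "g \<notin> fs.span B"
  proof
    assume "g \<in> fs.span B"
    then have "- g \<in> fs.span B" by (rule fs.span_neg)
    \<comment> \<open>With \<open>w = - g\<close> and \<open>c = 1\<close> the sum is the zero
      function, whose graph is a segment and hence null at the exponent halfway between 1 and
      \<open>s\<close>.\<close>
    then have "\<not> hnull ((1 + s) / 2) (graph_on (- g + fscale 1 g) {0..1})" using s by (intro lower) auto
    then show False using hnull_graph_0[of "(1 + s) / 2"] s by simp
  qed
  moreover have "fs.span (insert g B) \<subseteq> H_s s \<union> {0}"
  proof
    fix v assume "v \<in> fs.span (insert g B)"
    then obtain c where c: "v - fscale c g \<in> fs.span B" by (auto simp: fs.span_insert)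
    show "v \<in> H_s s \<union> {0}"
    proof (cases "c = 0")
      case True
      then show ?thesis using c B(2) by auto
    next
      case False
      then show ?thesis using mem[OF c False] by simp
    qed
  qed
  ultimately show ?thesis by blast
qed

lemma independent_H_s_extend:
  assumes s: "1 < s" "s \<le> 2" and B: "finite B" "\<not> fs.dependent B" "fs.span B \<subseteq> H_s s \<union> {0}"
  shows "\<exists>B'. B \<subseteq> B' \<and> finite B' \<and> card B' = card B + m \<and> \<not> fs.dependent B' \<and> fs.span B' \<subseteq> H_s s \<union> {0}"
proof (induction m)
  case 0
  show ?case by (intro exI[of _ B] conjI B) simp_all
next
  case (Suc m)
  then obtain B' where B': "B \<subseteq> B'" "finite B'" "card B' = card B + m" "\<not> fs.dependent B'"
    "fs.span B' \<subseteq> H_s s \<union> {0}" by blast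
  obtain g where g: "g \<notin> fs.span B'" "fs.span (insert g B') \<subseteq> H_s s \<union> {0}"
    using span_H_s_extend[OF s B'(2,5)] by blast
  have "g \<notin> B'" using g(1) fs.span_base by blast
  then have "card (insert g B') = card B + Suc m" using B'(2,3) by simp
  moreover have "B \<subseteq> insert g B'" "finite (insert g B')" using B'(1,2) by auto
  ultimately show ?case using g(2) fs.independent_insertI[OF g(1) B'(4)] by blast
qed

theorem theorem3p16:
  fixes s :: real and m n :: nat
  assumes "1 < s" and "s \<le> 2"
  shows "pair_lineable (H_s s) n (n + m)"
  unfolding pair_lineable_def
proof (intro conjI allI impI)
  \<comment> \<open>Plain lineability is the extension of the zero space, starting from the empty
    basis.\<close>
  have "\<not> fs.dependent {}" "fs.span {} \<subseteq> H_s s \<union> {0}"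
    by (simp_all add: fs.independent_empty)
  then obtain B where B: "finite B" "card B = card ({} :: (real \<Rightarrow> real) set) + n"
    "\<not> fs.dependent B" "fs.span B \<subseteq> H_s s \<union> {0}"
    using independent_H_s_extend[OF assms finite.emptyI, where m = n] by metis
  then show "lineable (H_s s) n"
    unfolding lineable_def fsubspace_def fdim_eq_def using fs.subspace_span[of B]
    by (intro exI[of _ "fs.span B"]) auto
next
  fix W assume W: "fsubspace W \<and> fdim_eq W n \<and> W \<subseteq> H_s s \<union> {0}"
  then obtain B where B: "finite B" "card B = n" "\<not> fs.dependent B" "fs.span B = W"
    unfolding fdim_eq_def by blast
  obtain B' where B': "B \<subseteq> B'" "finite B'" "card B' = n + m" "\<not> fs.dependent B'"
    "fs.span B' \<subseteq> H_s s \<union> {0}"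
    using independent_H_s_extend[OF assms B(1,3)] W B(2,4) by metis
  have "W \<subseteq> fs.span B'" using B(4) fs.span_mono[OF B'(1)] by simp
  then show "\<exists>V. fsubspace V \<and> fdim_eq V (n + m) \<and> W \<subseteq> V \<and> V \<subseteq> H_s s \<union> {0}"
    unfolding fsubspace_def fdim_eq_def using B' fs.subspace_span[of B']
    by (intro exI[of _ "fs.span B'"]) auto
qed

end
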